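(* For all $q>0$ and $\varepsilon\in(0,1)$ there exists some nonnegative sequence $\{c_k\}_{k\ge1}$ converging to $\infty$ such that, as $n\to\infty$, $$\mathbb{P}\left(d_{J_1}(\mathcal{J}^{(n)},\mathcal{J})\ge 3\kappa(q,\varepsilon)(\log n)n^{-1/2+\varepsilon/2}\right)=o(n^{-q}),$$ where $d_{J_1}$ depends on $\{c_k\}_k$ as described in the context. In particular, $\mathcal{J}^{(n)}$ converges strongly (i.e. almost surely) to $\mathcal{J}$ as $n\to\infty$ in the $J_1$ (Skorokhod) topology over $\mathcal{D}(\mathbb{R}_+,\mathcal{E}_\star)$.
   Context: Let $p\ge1$, $\mathcal{E}=\{1,\dots,p\}$, and let $\boldsymbol{\Lambda}(t)=\{\Lambda_{ij}(t)\}_{i,j\in\mathcal{E}}$, $t\ge0$, be an intensity matrix function: Borel measurable, integrable over compact intervals, with $\Lambda_{ii}(t)\le0$, $\Lambda_{ij}(t)\ge0$ for $i\ne j$, and $\sum_j\Lambda_{ij}(t)\le0$. Standing assumption: $\sup_{i\in\mathcal{E},t\ge0}|\Lambda_{ii}(t)|<\infty$. Let $\boldsymbol{\alpha}=(\alpha_i)_{i\in\mathcal{E}}$ be a probability vector and $\lambda_0=\lceil\sup_{i,t}|\Lambda_{ii}(t)|\rceil$ (positive, as it is a Poisson intensity). The probability space $(\Omega,\mathcal{F},\mathbb{P})$ supports the following independent components: two independent Poisson processes $\mathcal{N},\mathcal{M}$ of intensity $\lambda_0$; two independent sequences of independent Poisson processes $\{\widehat{\mathcal{N}}^{(k)}\}_{k\ge\lambda_0+1}$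 and $\{\widehat{\mathcal{M}}^{(k)}\}_{k\ge\lambda_0+1}$ of intensity $1$; and i.i.d. $\mathrm{U}(0,1)$ variables $\{U_\ell\}_{\ell\ge0}$. Process $\mathcal{J}=\{J(t)\}_{t\ge0}$: let $J(0)=i$ if $U_0\in[\sum_{j<i}\alpha_j,\sum_{j\le i}\alpha_j)$. Let $\chi_0=0$ and let $\chi_1<\chi_2<\cdots$ be the arrival times of $\mathcal{N}$; $J$ is constant on each $[\chi_\ell,\chi_{\ell+1})$. On $\{J(\chi_\ell-)=i\}$, $i\in\mathcal{E}$, set $J(\chi_\ell)=k\in\mathcal{E}$ if $U_\ell\in[\sum_{j<k}(\lambda_0^{-1}\Lambda_{ij}(\chi_\ell)+\delta_{ij}),\sum_{j\le k}(\lambda_0^{-1}\Lambda_{ij}(\chi_\ell)+\delta_{ij}))$, and the process terminates (moves forever to a cemetery state $\star\notin\mathcal{E}$) if $U_\ell\in[1+\sum_{j\in\mathcal{E}}\lambda_0^{-1}\Lambda_{ij}(\chi_\ell),1)$. Then $\mathcal{J}$ is a time-inhomogeneous Markov jump process with initial distribution $\boldsymbol{\alpha}$ and intensity matrix function $\boldsymbol{\Lambda}(\cdot)$. For $n\ge\lambda_0$, $\mathcal{N}^{(n)}$ is the superposition of $\mathcal{N},\widehat{\mathcal{N}}^{(\lambda_0+1)},\dots,\widehat{\mathcal{N}}^{(n)}$ and $\mathcal{M}^{(n)}$ is the superposition of $\mathcal{M},\widehat{\mathcal{M}}^{(\lambda_0+1)},\dots,\widehat{\mathcal{M}}^{(n)}$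 (both Poisson of intensity $n$), with arrival times $\{\chi^{(n)}_\ell\}_{\ell\ge0}$ and $\{\theta^{(n)}_\ell\}_{\ell\ge0}$ respectively, $\chi^{(n)}_0=\theta^{(n)}_0=0$. The process $\mathcal{J}^{(n)}=\{J^{(n)}(t)\}_{t\ge0}$ is $J^{(n)}(t)=J(\chi^{(n)}_\ell)$ for $t\in[\theta^{(n)}_\ell,\theta^{(n)}_{\ell+1})$. Write $\mathcal{E}_\star=\mathcal{E}\cup\{\star\}$, with discrete metric $d(i,j)=1-\delta_{ij}$, and $\mathcal{D}(\mathbb{R}_+,\mathcal{E}_\star)$ for the càdlàg functions from $\mathbb{R}_+=[0,\infty)$ to $\mathcal{E}_\star$. Given $\{c_k\}_{k\ge1}$, for $y,z\in\mathcal{D}(\mathbb{R}_+,\mathcal{E}_\star)$, $$d_{J_1}(y,z)=\inf_{\Delta\in\mathbb{H}}\left\{\left(\sum_{k=1}^\infty2^{-k}\sup_{s\le c_k}d(y(\Delta(s)),z(s))\right)\vee\sup_{s\ge0}|\Delta(s)-s|\right\},$$ where $\mathbb{H}$ is the set of homeomorphisms of $\mathbb{R}_+$. For $q>0$ and $\varepsilon\in(0,1)$, $\kappa(q,\varepsilon)>0$ denotes a constant (one exists) such that $\mathbb{P}\big(\max_{1\le\ell\le\lfloor n^{1+\varepsilon}\rfloor}|\theta^{(n)}_\ell-\chi^{(n)}_\ell|\ge\kappa(q,\varepsilon)(\log n)n^{-1/2+\varepsilon/2}\big)=o(n^{-q})$ as $n\to\infty$. *)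

theory Defs
  imports "HOL-Probability.Probability" "HOL-Library.Landau_Symbols"
begin

section \<open>Intensity matrix functions\<close>

definition intensity_matrix_function :: "nat \<Rightarrow> (nat \<Rightarrow> nat \<Rightarrow> real \<Rightarrow> real) \<Rightarrow> bool" where
  "intensity_matrix_function p \<Lambda> \<longleftrightarrow>
     (\<forall>i\<in>{1..p}. \<forall>j\<in>{1..p}. set_borel_measurable borel {0..} (\<Lambda> i j) \<and>
        (\<forall>a b. 0 \<le> a \<longrightarrow> set_integrable lborel {a..b} (\<Lambda> i j))) \<and>
     (\<forall>t\<ge>0. \<forall>i\<in>{1..p}. \<Lambda> i i t \<le> 0 \<and> (\<forall>j\<in>{1..p}. i \<noteq> j \<longrightarrow> 0 \<le> \<Lambda> i j t) \<and>
        (\<Sum>j=1..p. \<Lambda> i j t) \<le> 0)"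

definition exit_rates :: "nat \<Rightarrow> (nat \<Rightarrow> nat \<Rightarrow> real \<Rightarrow> real) \<Rightarrow> real set" where
  "exit_rates p \<Lambda> = {\<bar>\<Lambda> i i t\<bar> | i t. i \<in> {1..p} \<and> 0 \<le> t}"

definition lambda0 :: "nat \<Rightarrow> (nat \<Rightarrow> nat \<Rightarrow> real \<Rightarrow> real) \<Rightarrow> nat" where
  "lambda0 p \<Lambda> = nat \<lceil>Sup (exit_rates p \<Lambda>)\<rceil>"

definition probability_vector :: "nat \<Rightarrow> (nat \<Rightarrow> real) \<Rightarrow> bool" where
  "probability_vector p \<alpha> \<longleftrightarrow> (\<forall>i\<in>{1..p}. 0 \<le> \<alpha> i) \<and> (\<Sum>i=1..p. \<alpha> i) = 1"


section \<open>Poisson processes and independence\<close>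

definition poisson_process :: "'w measure \<Rightarrow> real \<Rightarrow> (real \<Rightarrow> 'w \<Rightarrow> nat) \<Rightarrow> bool" where
  "poisson_process P r X \<longleftrightarrow>
     0 < r \<and>
     (\<forall>t\<ge>0. X t \<in> P \<rightarrow>\<^sub>M count_space UNIV) \<and>
     (\<forall>\<omega>\<in>space P. X 0 \<omega> = 0 \<and> mono_on {0..} (\<lambda>t. X t \<omega>) \<and>
        (\<forall>t\<ge>0. continuous (at_right t) (\<lambda>s. X s \<omega>))) \<and>
     (\<forall>s t. 0 \<le> s \<and> s < t \<longrightarrow>
        distr P (count_space UNIV) (\<lambda>\<omega>. X t \<omega> - X s \<omega>) = measure_pmf (poisson_pmf (r * (t - s)))) \<and>
     (\<forall>(m::nat) \<tau>. 0 \<le> \<tau> 0 \<and> (\<forall>i<m. \<tau> i \<le> \<tau> (Suc i)) \<longrightarrow>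
        prob_space.indep_vars P (\<lambda>_. count_space UNIV)
          (\<lambda>i \<omega>. X (\<tau> (Suc i)) \<omega> - X (\<tau> i) \<omega>) {..<m})"

datatype component = C_N | C_M | C_Nh nat | C_Mh nat | C_U nat

definition process_events :: "'w measure \<Rightarrow> (real \<Rightarrow> 'w \<Rightarrow> nat) \<Rightarrow> 'w set set" where
  "process_events P X = sigma_sets (space P) {X t -` A \<inter> space P | t A. 0 \<le> t}"

fun component_events ::
  "'w measure \<Rightarrow> (real \<Rightarrow> 'w \<Rightarrow> nat) \<Rightarrow> (real \<Rightarrow> 'w \<Rightarrow> nat) \<Rightarrow>
   (nat \<Rightarrow> real \<Rightarrow> 'w \<Rightarrow> nat) \<Rightarrow> (nat \<Rightarrow> real \<Rightarrow> 'w \<Rightarrow> nat) \<Rightarrow> (nat \<Rightarrow> 'w \<Rightarrow> real) \<Rightarrow>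
   component \<Rightarrow> 'w set set" where
  "component_events P N M Nh Mh U C_N = process_events P N"
| "component_events P N M Nh Mh U C_M = process_events P M"
| "component_events P N M Nh Mh U (C_Nh k) = process_events P (Nh k)"
| "component_events P N M Nh Mh U (C_Mh k) = process_events P (Mh k)"
| "component_events P N M Nh Mh U (C_U l) = sets (vimage_algebra (space P) (U l) borel)"

definition independent_components ::
  "'w measure \<Rightarrow> nat \<Rightarrow> (real \<Rightarrow> 'w \<Rightarrow> nat) \<Rightarrow> (real \<Rightarrow> 'w \<Rightarrow> nat) \<Rightarrow>
   (nat \<Rightarrow> real \<Rightarrow> 'w \<Rightarrow> nat) \<Rightarrow> (nat \<Rightarrow> real \<Rightarrow> 'w \<Rightarrow> nat) \<Rightarrow> (nat \<Rightarrow> 'w \<Rightarrow> real) \<Rightarrow> bool" where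
  "independent_components P l0 N M Nh Mh U \<longleftrightarrow>
     prob_space.indep_sets P (component_events P N M Nh Mh U)
       ({C_N, C_M} \<union> C_Nh ` {l0 + 1..} \<union> C_Mh ` {l0 + 1..} \<union> range C_U)"

text \<open>If the counting path stays below \<open>l\<close>, which has probability zero for a Poisson process,
  the infimum is over the empty set and the value is meaningless.\<close>

definition arrival :: "(real \<Rightarrow> 'w \<Rightarrow> nat) \<Rightarrow> 'w \<Rightarrow> nat \<Rightarrow> real" where
  "arrival X \<omega> l = Inf {t. 0 \<le> t \<and> l \<le> X t \<omega>}"

definition superposition ::
  "nat \<Rightarrow> (real \<Rightarrow> 'w \<Rightarrow> nat) \<Rightarrow> (nat \<Rightarrow> real \<Rightarrow> 'w \<Rightarrow> nat) \<Rightarrow> nat \<Rightarrow> real \<Rightarrow> 'w \<Rightarrow> nat" where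
  "superposition l0 X Xh n t \<omega> = X t \<omega> + (\<Sum>k=l0+1..n. Xh k t \<omega>)"


section \<open>The jump process and its approximations\<close>

text \<open>States are \<open>Some i\<close> with \<open>i \<in> {1..p}\<close>; the cemetery state is \<open>None\<close>.\<close>

definition states :: "nat \<Rightarrow> nat option set" where
  "states p = insert None (Some ` {1..p})"

definition in_cell :: "(nat \<Rightarrow> real) \<Rightarrow> real \<Rightarrow> nat \<Rightarrow> bool" where
  "in_cell w u k \<longleftrightarrow> (\<Sum>j=1..<k. w j) \<le> u \<and> u < (\<Sum>j=1..k. w j)"

text \<open>For nonnegative weights the cells are disjoint and cover \<open>[0, \<Sum>j=1..p. w j)\<close>, so for
  \<open>u\<close> in \<open>[0, 1)\<close> the value is \<open>None\<close> exactly when \<open>u\<close> is at least the total weight.\<close>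

definition select_state :: "nat \<Rightarrow> (nat \<Rightarrow> real) \<Rightarrow> real \<Rightarrow> nat option" where
  "select_state p w u =
     (if \<exists>k\<in>{1..p}. in_cell w u k then Some (THE k. k \<in> {1..p} \<and> in_cell w u k) else None)"

text \<open>The state entered at the \<open>l\<close>-th arrival time \<open>T l\<close>; by constancy between arrivals, the
  state just before \<open>T (Suc l)\<close> is the one entered at \<open>T l\<close>.\<close>

primrec embedded_chain ::
  "nat \<Rightarrow> (nat \<Rightarrow> nat \<Rightarrow> real \<Rightarrow> real) \<Rightarrow> (nat \<Rightarrow> real) \<Rightarrow> nat \<Rightarrow> (nat \<Rightarrow> real) \<Rightarrow> (nat \<Rightarrow> real) \<Rightarrow>
   nat \<Rightarrow> nat option" where
  "embedded_chain p \<Lambda> \<alpha> l0 T u 0 = select_state p \<alpha> (u 0)"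
| "embedded_chain p \<Lambda> \<alpha> l0 T u (Suc l) =
     (case embedded_chain p \<Lambda> \<alpha> l0 T u l of
        None \<Rightarrow> None
      | Some i \<Rightarrow> select_state p
          (\<lambda>j. \<Lambda> i j (T (Suc l)) / real l0 + (if i = j then 1 else 0)) (u (Suc l)))"

definition step_path :: "(nat \<Rightarrow> real) \<Rightarrow> (nat \<Rightarrow> 'b) \<Rightarrow> real \<Rightarrow> 'b" where
  "step_path T Y t = Y (THE l. T l \<le> t \<and> t < T (Suc l))"

definition jump_process ::
  "nat \<Rightarrow> (nat \<Rightarrow> nat \<Rightarrow> real \<Rightarrow> real) \<Rightarrow> (nat \<Rightarrow> real) \<Rightarrow> nat \<Rightarrow> (real \<Rightarrow> 'w \<Rightarrow> nat) \<Rightarrow>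
   (nat \<Rightarrow> 'w \<Rightarrow> real) \<Rightarrow> 'w \<Rightarrow> real \<Rightarrow> nat option" where
  "jump_process p \<Lambda> \<alpha> l0 N U \<omega> =
     step_path (arrival N \<omega>) (embedded_chain p \<Lambda> \<alpha> l0 (arrival N \<omega>) (\<lambda>l. U l \<omega>))"

text \<open>\<open>J\<close> is the path being approximated; \<open>Nn\<close> supplies the sampling times and \<open>Mn\<close> the times at
  which the sampled values are displayed.\<close>

definition approx_process ::
  "('w \<Rightarrow> real \<Rightarrow> 'b) \<Rightarrow> (real \<Rightarrow> 'w \<Rightarrow> nat) \<Rightarrow> (real \<Rightarrow> 'w \<Rightarrow> nat) \<Rightarrow> 'w \<Rightarrow> real \<Rightarrow> 'b" where
  "approx_process J Nn Mn \<omega> = step_path (arrival Mn \<omega>) (\<lambda>l. J \<omega> (arrival Nn \<omega> l))"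


section \<open>Skorokhod space\<close>

text \<open>Paths are total functions on the reals of which only the values on \<open>[0, \<infinity>)\<close> matter. One-sided
  limits in a discrete space mean being eventually constant.\<close>

definition cadlag_paths :: "'b set \<Rightarrow> (real \<Rightarrow> 'b) set" where
  "cadlag_paths S = {y. (\<forall>t\<ge>0. y t \<in> S) \<and>
     (\<forall>t\<ge>0. \<forall>\<^sub>F s in at_right t. y s = y t) \<and>
     (\<forall>t>0. \<exists>a\<in>S. \<forall>\<^sub>F s in at_left t. y s = a)}"

definition time_changes :: "(real \<Rightarrow> real) set" where
  "time_changes = {\<Delta>. \<exists>\<Delta>'. homeomorphism {0..} {0..} \<Delta> \<Delta>'}"

definition discrete_dist :: "'b \<Rightarrow> 'b \<Rightarrow> real" where
  "discrete_dist a b = (if a = b then 0 else 1)"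

text \<open>Values are taken in \<^typ>\<open>ennreal\<close> because the supremum over all times may be infinite for some
  time changes. The sum starts at \<open>k = 1\<close>, so \<open>c 0\<close> is never used.\<close>

definition dJ1 :: "(nat \<Rightarrow> real) \<Rightarrow> (real \<Rightarrow> 'b) \<Rightarrow> (real \<Rightarrow> 'b) \<Rightarrow> ennreal" where
  "dJ1 c y z = (INF \<Delta>\<in>time_changes.
     max (\<Sum>k. ennreal ((1/2) ^ Suc k) *
            (SUP s\<in>{0..c (Suc k)}. ennreal (discrete_dist (y (\<Delta> s)) (z s))))
         (SUP s\<in>{0..}. ennreal \<bar>\<Delta> s - s\<bar>))"

text \<open>\<^const>\<open>dJ1\<close> is not symmetric, so balls are taken around the second argument. For every
  nonnegative \<open>c\<close> tending to infinity this is the Skorokhod topology: \<open>dJ1 c (y n) z\<close> tends to 0 iff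
  there are time changes \<open>\<Delta> n\<close>, uniformly close to the identity, such that \<open>y n \<circ> \<Delta> n\<close> converges
  to \<open>z\<close> uniformly on compact intervals.\<close>

definition J1_open :: "(nat \<Rightarrow> real) \<Rightarrow> 'b set \<Rightarrow> (real \<Rightarrow> 'b) set \<Rightarrow> bool" where
  "J1_open c S G \<longleftrightarrow> G \<subseteq> cadlag_paths S \<and>
     (\<forall>z\<in>G. \<exists>r>0. {y \<in> cadlag_paths S. dJ1 c y z < r} \<subseteq> G)"

definition J1_topology :: "(nat \<Rightarrow> real) \<Rightarrow> 'b set \<Rightarrow> (real \<Rightarrow> 'b) topology" where
  "J1_topology c S = topology (J1_open c S)"

lemma istopology_J1_open: "istopology (J1_open c S)"
  unfolding istopology_def
proof (intro conjI allI impI)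
  fix A B :: "(real \<Rightarrow> 'a) set"
  assume A: "J1_open c S A" and B: "J1_open c S B"
  show "J1_open c S (A \<inter> B)"
    unfolding J1_open_def
  proof (intro conjI ballI)
    show "A \<inter> B \<subseteq> cadlag_paths S" using A by (auto simp: J1_open_def)
    fix z assume z: "z \<in> A \<inter> B"
    obtain r1 where r1: "r1 > 0" "{y \<in> cadlag_paths S. dJ1 c y z < r1} \<subseteq> A"
      using A z unfolding J1_open_def by blast
    obtain r2 where r2: "r2 > 0" "{y \<in> cadlag_paths S. dJ1 c y z < r2} \<subseteq> B"
      using B z unfolding J1_open_def by blast
    have "min r1 r2 > 0" using r1(1) r2(1) by simp
    moreover have "{y \<in> cadlag_paths S. dJ1 c y z < min r1 r2} \<subseteq> A \<inter> B"
      using r1(2) r2(2) by auto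
    ultimately show "\<exists>r>0. {y \<in> cadlag_paths S. dJ1 c y z < r} \<subseteq> A \<inter> B" by blast
  qed
next
  fix \<K> :: "(real \<Rightarrow> 'a) set set"
  assume K: "\<forall>K\<in>\<K>. J1_open c S K"
  show "J1_open c S (\<Union>\<K>)"
    unfolding J1_open_def
  proof (intro conjI ballI)
    show "\<Union>\<K> \<subseteq> cadlag_paths S" using K by (auto simp: J1_open_def)
    fix z assume "z \<in> \<Union>\<K>"
    then obtain K where "K \<in> \<K>" "z \<in> K" by blast
    then show "\<exists>r>0. {y \<in> cadlag_paths S. dJ1 c y z < r} \<subseteq> \<Union>\<K>"
      using K unfolding J1_open_def by (meson Union_upper subset_trans)
  qed
qed

lemma openin_J1_topology: "openin (J1_topology c S) = J1_open c S"
  unfolding J1_topology_def by (rule topology_inverse') (rule istopology_J1_open)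

lemma topspace_J1_topology: "topspace (J1_topology c S) = cadlag_paths S"
proof -
  have "J1_open c S (cadlag_paths S)"
    unfolding J1_open_def by (auto intro: exI[of _ 1])
  then show ?thesis
    unfolding topspace_def openin_J1_topology by (blast dest: J1_open_def[THEN iffD1])
qed

end

theory Submission
  imports Defs "HOL-Real_Asymp.Real_Asymp"
begin

text \<open>Almost surely every superposition is a counting path that takes each value, so its \<open>l\<close>-th arrival
  time is the moment at which the count becomes \<open>l\<close>, and \<^term>\<open>step_path\<close> reads off the value at the current
  count (\<open>step_path_arrival\<close>). Since the arrivals of \<open>N\<close> are among those of the superposition \<open>Nn n\<close>,
  the jump process \<open>J\<close> is constant between the arrivals \<open>\<chi> l\<close> of \<open>Nn n\<close>, and the approximation \<open>Jn n\<close>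
  runs through the same values, moving at the arrivals \<open>\<theta> l\<close> of \<open>Mn n\<close> instead. The piecewise linear time
  change that carries \<open>\<chi> l\<close> to \<open>\<theta> l\<close> for \<open>l \<le> L\<close>, where \<open>L\<close> is the integer part of \<open>n powr (1 + \<epsilon>)\<close>, therefore
  turns \<open>Jn n\<close> into \<open>J\<close> exactly on \<open>[0, \<chi> L)\<close>. It differs from the identity by no more than the largest
  \<open>\<bar>\<theta> l - \<chi> l\<bar>\<close>, which is the quantity controlled by \<open>\<kappa>\<close> (\<open>resampled_path_time_change\<close>).

  It remains to see that \<open>\<chi> L\<close> is large. Its typical size is \<open>n powr \<epsilon>\<close>, and a Chernoff bound shows that
  it falls below half of this with exponentially small probability (\<open>short_horizon_prob\<close>). With \<open>c k = k\<close>
  the part of the series in \<^const>\<open>dJ1\<close> that looks beyond \<open>\<chi> L\<close> is then exponentially small in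
  \<open>n powr \<epsilon>\<close>, hence below the bound on the time change (\<open>dJ1_resampled_le\<close>, \<open>dJ1_outer_measure\<close>). For the
  almost sure convergence the exceptional probabilities with \<open>q = 2\<close> are summable, and for an arbitrary
  \<open>c\<close> the tail of the series still tends to 0 (\<open>AE_J1_limit\<close>).

  That superpositions almost surely skip no value follows from the probability generating function of
  their increments (\<open>total_generating_function\<close>): an increment of at least 2 over a short time \<open>\<eta>\<close> has
  probability \<open>O(\<eta>\<^sup>2)\<close>.\<close>

section \<open>Counting paths and their arrival times\<close>

text \<open>Jumps larger than 1 are allowed; they are excluded by \<open>onto_counting_path\<close> below, since a path
  with unit jumps that is unbounded is the same as one that takes every value.\<close>

definition counting_path :: "(real \<Rightarrow> nat) \<Rightarrow> bool" where
  "counting_path f \<longleftrightarrow>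
     f 0 = 0 \<and> mono_on {0..} f \<and> (\<forall>t\<ge>0. continuous (at_right t) f)"

definition onto_counting_path :: "(real \<Rightarrow> nat) \<Rightarrow> bool" where
  "onto_counting_path f \<longleftrightarrow> counting_path f \<and> (\<forall>l. \<exists>t\<ge>0. f t = l)"

lemma counting_path_mono:
  "counting_path f \<Longrightarrow> 0 \<le> s \<Longrightarrow> s \<le> t \<Longrightarrow> f s \<le> f t"
  by (auto simp: counting_path_def mono_on_def)

lemma counting_path_right_constant:
  assumes "counting_path f" "0 \<le> t"
  shows "\<forall>\<^sub>F s in at_right t. f s = f t"
proof -
  have "(f \<longlongrightarrow> f t) (at_right t)"
    using assms by (auto simp: counting_path_def continuous_within)
  then show ?thesis
    by (simp add: tendsto_discrete)
qed

lemma counting_path_left_constant: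
  assumes f: "counting_path f" and t: "0 < t"
  shows "\<exists>s\<in>{0..<t}. \<forall>r\<in>{s..<t}. f r = f s"
proof -
  have "finite (f ` {0..<t})"
    by (rule finite_subset[of _ "{..f t}"]) (auto intro: counting_path_mono[OF f])
  then have "Max (f ` {0..<t}) \<in> f ` {0..<t}"
    using t by (intro Max_in) auto
  then obtain s where s: "s \<in> {0..<t}" "f s = Max (f ` {0..<t})"
    by force
  have "f r = f s" if "r \<in> {s..<t}" for r
  proof (rule antisym)
    show "f r \<le> f s"
      unfolding s(2) using that s(1) \<open>finite (f ` {0..<t})\<close> by (intro Max_ge) auto
    show "f s \<le> f r"
      using that s(1) by (intro counting_path_mono[OF f]) auto
  qed
  then show ?thesis
    using s(1) by blast
qed

lemma counting_path_sum:
  assumes "\<And>i. i \<in> I \<Longrightarrow> counting_path (f i)"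
  shows "counting_path (\<lambda>t. \<Sum>i\<in>I. f i t)"
  using assms unfolding counting_path_def mono_on_def
  by (auto intro!: sum_mono continuous_sum)

lemma counting_path_add:
  "counting_path f \<Longrightarrow> counting_path g \<Longrightarrow> counting_path (\<lambda>t. f t + g t)"
  unfolding counting_path_def mono_on_def
  by (auto intro!: add_mono continuous_add)

lemma bdd_below_arrival: "bdd_below {t. 0 \<le> t \<and> l \<le> X t \<omega>}" for X :: "real \<Rightarrow> 'w \<Rightarrow> nat"
  by (rule bdd_belowI[of _ 0]) auto

lemma arrival_nonneg: "\<exists>t\<ge>0. l \<le> X t \<omega> \<Longrightarrow> 0 \<le> arrival X \<omega> l"
  unfolding arrival_def by (rule cInf_greatest) auto

text \<open>By right-continuity the infimum in the definition of an arrival time is attained.\<close>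

lemma arrival_le_iff:
  assumes X: "counting_path (\<lambda>t. X t \<omega>)" and ex: "\<exists>t\<ge>0. l \<le> X t \<omega>" and t: "0 \<le> t"
  shows "arrival X \<omega> l \<le> t \<longleftrightarrow> l \<le> X t \<omega>"
proof
  assume "l \<le> X t \<omega>"
  then show "arrival X \<omega> l \<le> t"
    unfolding arrival_def using t by (intro cInf_lower bdd_below_arrival) auto
next
  assume le: "arrival X \<omega> l \<le> t"
  let ?a = "arrival X \<omega> l"
  have a: "0 \<le> ?a" by (intro arrival_nonneg ex)
  obtain b where b: "b > ?a" "\<And>s. ?a < s \<Longrightarrow> s < b \<Longrightarrow> X s \<omega> = X ?a \<omega>"
    using counting_path_right_constant[OF X a] by (auto simp: eventually_at_right_field)
  have "Inf {t. 0 \<le> t \<and> l \<le> X t \<omega>} < b"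
    using b(1) by (simp add: arrival_def)
  then obtain s where s: "0 \<le> s" "l \<le> X s \<omega>" "s < b"
    using ex by (subst (asm) cInf_less_iff) (auto intro: bdd_below_arrival)
  have "?a \<le> s"
    unfolding arrival_def using s by (intro cInf_lower bdd_below_arrival) auto
  then have "X s \<omega> = X ?a \<omega>"
    using b(2)[of s] s(3) by (cases "s = ?a") auto
  then have "l \<le> X ?a \<omega>" using s(2) by simp
  also have "\<dots> \<le> X t \<omega>" by (rule counting_path_mono[OF X a le])
  finally show "l \<le> X t \<omega>" .
qed

context
  fixes X :: "real \<Rightarrow> 'w \<Rightarrow> nat" and \<omega> :: 'w
  assumes X: "onto_counting_path (\<lambda>t. X t \<omega>)"
begin

lemma onto_reaches: "\<exists>t\<ge>0. l \<le> X t \<omega>"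
  using X unfolding onto_counting_path_def by (metis le_refl)

lemma onto_arrival_le_iff: "0 \<le> t \<Longrightarrow> arrival X \<omega> l \<le> t \<longleftrightarrow> l \<le> X t \<omega>"
  using X by (intro arrival_le_iff onto_reaches) (auto simp: onto_counting_path_def)

lemma onto_arrival_nonneg: "0 \<le> arrival X \<omega> l"
  by (intro arrival_nonneg onto_reaches)

lemma onto_arrival_0: "arrival X \<omega> 0 = 0"
  using onto_arrival_nonneg[of 0] onto_arrival_le_iff[of 0 0] by simp

lemma onto_arrival_less: "arrival X \<omega> l < arrival X \<omega> (Suc l)"
proof -
  obtain t where t: "0 \<le> t" "X t \<omega> = l"
    using X by (auto simp: onto_counting_path_def)
  show ?thesis
    using onto_arrival_le_iff[OF t(1), of l] onto_arrival_le_iff[OF t(1), of "Suc l"] t(2) by simp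
qed

lemma count_at_arrival: "X (arrival X \<omega> l) \<omega> = l"
  using onto_arrival_le_iff[of "arrival X \<omega> l" l] onto_arrival_nonneg[of l]
    onto_arrival_le_iff[of "arrival X \<omega> l" "Suc l"] onto_arrival_less[of l] by simp

text \<open>The index of the interval between arrivals that contains \<open>t\<close> is the count at time \<open>t\<close>.\<close>

lemma step_path_arrival:
  assumes "0 \<le> t"
  shows "step_path (arrival X \<omega>) Y t = Y (X t \<omega>)"
proof -
  have "(THE l. arrival X \<omega> l \<le> t \<and> t < arrival X \<omega> (Suc l)) = X t \<omega>"
  proof (rule the_equality)
    show "arrival X \<omega> (X t \<omega>) \<le> t \<and> t < arrival X \<omega> (Suc (X t \<omega>))"
      using onto_arrival_le_iff[OF assms, of "X t \<omega>"]
        onto_arrival_le_iff[OF assms, of "Suc (X t \<omega>)"] by auto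
  next
    fix l assume "arrival X \<omega> l \<le> t \<and> t < arrival X \<omega> (Suc l)"
    then show "l = X t \<omega>"
      using onto_arrival_le_iff[OF assms, of l] onto_arrival_le_iff[OF assms, of "Suc l"] by simp
  qed
  then show ?thesis by (simp add: step_path_def)
qed

lemma step_path_cadlag:
  assumes "\<And>l. Y l \<in> S"
  shows "step_path (arrival X \<omega>) Y \<in> cadlag_paths S"
  unfolding cadlag_paths_def mem_Collect_eq
proof (intro conjI allI impI)
  have cp: "counting_path (\<lambda>t. X t \<omega>)" using X by (simp add: onto_counting_path_def)
  let ?y = "step_path (arrival X \<omega>) Y"
  show "?y t \<in> S" if "0 \<le> t" for t
    using step_path_arrival[OF that, of Y] assms by simp
  show "\<forall>\<^sub>F s in at_right t. ?y s = ?y t" if t: "0 \<le> t" for t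
    using counting_path_right_constant[OF cp t] eventually_at_right_less[of t]
  proof eventually_elim
    case (elim s)
    then show ?case using t step_path_arrival[of s Y] step_path_arrival[of t Y] by simp
  qed
  show "\<exists>a\<in>S. \<forall>\<^sub>F s in at_left t. ?y s = a" if t: "0 < t" for t
  proof -
    obtain s where s: "s \<in> {0..<t}" "\<And>r. r \<in> {s..<t} \<Longrightarrow> X r \<omega> = X s \<omega>"
      using counting_path_left_constant[OF cp t] by blast
    have "\<forall>\<^sub>F r in at_left t. r \<in> {s<..<t}"
      using s(1) by (intro eventually_at_leftI) auto
    then have "\<forall>\<^sub>F r in at_left t. ?y r = Y (X s \<omega>)"
    proof eventually_elim
      case (elim r)
      then have "0 \<le> r" "X r \<omega> = X s \<omega>"
        using s(1) s(2)[of r] by auto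
      then show ?case using step_path_arrival[of r Y] by simp
    qed
    then show ?thesis using assms by blast
  qed
qed

end

section \<open>Time changes\<close>

text \<open>The interpolant is linear between consecutive knots and a translation after the last one. Its
  deviation from the identity is piecewise linear, hence largest at a knot. The tail clause lets the
  induction bend the graph beyond the last knot.\<close>

lemma interpolating_time_change:
  fixes a b :: "nat \<Rightarrow> real" and m :: real
  assumes "a 0 = 0" "b 0 = 0"
    and "\<And>l. l < L \<Longrightarrow> a l < a (Suc l)" "\<And>l. l < L \<Longrightarrow> b l < b (Suc l)"
    and "\<And>l. l \<le> L \<Longrightarrow> \<bar>b l - a l\<bar> \<le> m"
  shows "\<exists>\<Delta>. strict_mono \<Delta> \<and> continuous_on UNIV \<Delta> \<and> (\<forall>l\<le>L. \<Delta> (a l) = b l) \<and>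
           (\<forall>s. \<bar>\<Delta> s - s\<bar> \<le> m) \<and> (\<forall>s\<ge>a L. \<Delta> s = s + (b L - a L))"
  using assms(3-5)
proof (induction L)
  case 0
  show ?case
    using 0(3)[of 0] assms(1,2)
    by (intro exI[of _ "\<lambda>s. s"]) (auto simp: strict_mono_def)
next
  case (Suc L)
  obtain f where mono: "strict_mono f" and cont: "continuous_on UNIV f"
    and val: "\<And>l. l \<le> L \<Longrightarrow> f (a l) = b l"
    and dev: "\<And>s. \<bar>f s - s\<bar> \<le> m" and tail: "\<And>s. s \<ge> a L \<Longrightarrow> f s = s + (b L - a L)"
    using Suc.IH Suc.prems by (metis le_SucI less_SucI)
  define d where "d = a (Suc L) - a L"
  define r where "r = (b (Suc L) - b L) / d"
  have d: "d > 0" and r: "r > 0" and rd: "r * d = b (Suc L) - b L"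
    using Suc.prems(1)[of L] Suc.prems(2)[of L] by (auto simp: d_def r_def)
  have aL: "a l \<le> a L" if "l \<le> L" for l
    using that
  proof (induction "L - l" arbitrary: l)
    case (Suc k)
    then have "a (Suc l) \<le> a L" "a l < a (Suc l)"
      using Suc.hyps(1)[of "Suc l"] \<open>\<And>l. l < Suc L \<Longrightarrow> a l < a (Suc l)\<close> by auto
    then show ?case by simp
  qed simp
  \<comment> \<open>Beyond \<open>a L\<close> the slope is changed from 1 to \<open>r\<close> for a duration \<open>d\<close>.\<close>
  define g where "g s = f s + (r - 1) * min (max (s - a L) 0) d" for s
  have g1: "g s = f s" if "s \<le> a L" for s
    using that d by (simp add: g_def)
  have g2: "g s = b L + r * (s - a L)" if "a L \<le> s" "s \<le> a (Suc L)" for s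
    using that tail[of s] by (simp add: g_def d_def min_def algebra_simps)
  have g3: "g s = s + (b (Suc L) - a (Suc L))" if "a (Suc L) \<le> s" for s
  proof -
    have "min (max (s - a L) 0) d = d" using that d by (auto simp: d_def)
    then have "g s = f s + (r * d - d)" by (simp add: g_def algebra_simps)
    also have "\<dots> = f s + (b (Suc L) - b L - (a (Suc L) - a L))" by (simp add: rd) (simp add: d_def)
    finally show ?thesis using tail[of s] that d by (simp add: d_def)
  qed
  have "g s < g t" if "s < t" for s t
  proof -
    have p1: "g s < g t" if "s < t" "t \<le> a L" for s t
      using that g1 strict_monoD[OF mono] by simp
    have p2: "g s < g t" if "s < t" "a L \<le> s" "t \<le> a (Suc L)" for s t
      using that g2 r by simp
    have p3: "g s < g t" if "s < t" "a (Suc L) \<le> s" for s t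
      using that g3 by simp
    have p12: "g s < g t" if "s < t" "t \<le> a (Suc L)" for s t
      using that p1[of s t] p1[of s "a L"] p2[of "a L" t] p2[of s t]
      by (cases "t \<le> a L"; cases "s < a L"; cases "t = a L") (auto intro: less_trans)
    show ?thesis
      using \<open>s < t\<close> p12[of s t] p12[of s "a (Suc L)"] p3[of "a (Suc L)" t] p3[of s t]
      by (cases "t \<le> a (Suc L)"; cases "s < a (Suc L)") (auto intro: less_trans)
  qed
  then have "strict_mono g" by (simp add: strict_mono_def)
  moreover have "continuous_on UNIV g"
    unfolding g_def by (intro continuous_intros cont)
  moreover have "g (a l) = b l" if "l \<le> Suc L" for l
  proof (cases "l = Suc L")
    case True
    then show ?thesis using g3[of "a (Suc L)"] by simp
  next
    case False
    then show ?thesis using that g1[OF aL] val by simp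
  qed
  moreover have "\<bar>g s - s\<bar> \<le> m" for s
  proof -
    consider "s \<le> a L" | "a L \<le> s" "s \<le> a (Suc L)" | "a (Suc L) \<le> s" by linarith
    then show ?thesis
    proof cases
      case 1
      then show ?thesis using dev g1 by simp
    next
      case 2
      \<comment> \<open>On the new piece the deviation interpolates linearly between its values at the ends.\<close>
      define u where "u = (s - a L) / d"
      have u: "0 \<le> u" "u \<le> 1" "s - a L = u * d"
        using 2 d by (auto simp: u_def d_def)
      have "g s - s = (b L - a L) + u * (r * d) - u * d"
        using g2[OF 2] u(3) by (simp add: algebra_simps)
      also have "\<dots> = (1 - u) * (b L - a L) + u * (b (Suc L) - a (Suc L))"
        unfolding rd by (simp add: d_def algebra_simps)
      also have "\<bar>\<dots>\<bar> \<le> (1 - u) * m + u * m"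
        using u Suc.prems(3)[of L] Suc.prems(3)[of "Suc L"]
        by (intro order_trans[OF abs_triangle_ineq] add_mono)
          (auto simp: abs_mult intro!: mult_left_mono)
      finally show ?thesis by (simp add: algebra_simps)
    next
      case 3
      then show ?thesis using g3 Suc.prems(3)[of "Suc L"] by simp
    qed
  qed
  ultimately show ?case
    using g3 by blast
qed

text \<open>Staying within bounded distance of the identity makes an increasing continuous map surjective,
  by the intermediate value theorem.\<close>

lemma near_identity_time_change:
  fixes \<Delta> :: "real \<Rightarrow> real"
  assumes mono: "strict_mono \<Delta>" and cont: "continuous_on UNIV \<Delta>" and "\<Delta> 0 = 0"
    and dev: "\<And>s. \<bar>\<Delta> s - s\<bar> \<le> m"
  shows "\<Delta> \<in> time_changes"
proof -
  have "\<Delta> ` {0..} = {0..}"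
  proof (intro equalityI subsetI)
    show "t \<in> {0..}" if "t \<in> \<Delta> ` {0..}" for t
      using that strict_mono_less_eq[OF mono, of 0] \<open>\<Delta> 0 = 0\<close> by auto
    show "t \<in> \<Delta> ` {0..}" if "t \<in> {0..}" for t
    proof -
      have m: "0 \<le> m" using dev[of 0] by simp
      have "\<exists>s\<ge>0. s \<le> t + m \<and> \<Delta> s = t"
        using that m dev[of "t + m"] \<open>\<Delta> 0 = 0\<close>
        by (intro IVT' continuous_on_subset[OF cont]) auto
      then show ?thesis by force
    qed
  qed
  moreover have "inj_on \<Delta> {0..}"
    by (rule strict_mono_imp_inj_on[OF mono])
  moreover have "path_connected {0::real..}"
    by (intro convex_imp_path_connected convex_real_interval)
  ultimately have "\<exists>\<Delta>'. homeomorphism {0..} {0..} \<Delta> \<Delta>'"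
    using cont by (intro homeomorphism_into_1d) (auto intro: continuous_on_subset)
  then show ?thesis by (simp add: time_changes_def)
qed

text \<open>Here \<open>z\<close> is a path that is constant between the arrivals of \<open>X\<close>. Its values at the arrivals of
  \<open>X\<close> are displayed at the arrivals of \<open>Y\<close>, so the time change that carries the \<open>l\<close>-th arrival of \<open>X\<close> to
  the \<open>l\<close>-th arrival of \<open>Y\<close>, for \<open>l\<close> up to \<open>L\<close>, turns the displayed path back into \<open>z\<close>.\<close>

lemma resampled_path_time_change:
  fixes X Y :: "real \<Rightarrow> 'w \<Rightarrow> nat"
  assumes X: "onto_counting_path (\<lambda>t. X t \<omega>)" and Y: "onto_counting_path (\<lambda>t. Y t \<omega>)"
    and dev: "\<And>l. l \<in> {1..L} \<Longrightarrow> \<bar>arrival Y \<omega> l - arrival X \<omega> l\<bar> \<le> m" and m: "0 \<le> m"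
    and z: "\<And>s. 0 \<le> s \<Longrightarrow> z s = z (arrival X \<omega> (X s \<omega>))"
  shows "\<exists>\<Delta>\<in>time_changes.
           (\<forall>s\<in>{0..<arrival X \<omega> L}. step_path (arrival Y \<omega>) (\<lambda>l. z (arrival X \<omega> l)) (\<Delta> s) = z s) \<and>
           (\<forall>s. \<bar>\<Delta> s - s\<bar> \<le> m)"
proof -
  have dev': "\<bar>arrival Y \<omega> l - arrival X \<omega> l\<bar> \<le> m" if "l \<le> L" for l
    using that dev[of l] m onto_arrival_0[of X, OF X] onto_arrival_0[of Y, OF Y] by (cases l) auto
  obtain \<Delta> where \<Delta>: "strict_mono \<Delta>" "continuous_on UNIV \<Delta>"
    "\<And>l. l \<le> L \<Longrightarrow> \<Delta> (arrival X \<omega> l) = arrival Y \<omega> l" "\<And>s. \<bar>\<Delta> s - s\<bar> \<le> m"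
    using interpolating_time_change[of "arrival X \<omega>" "arrival Y \<omega>" L m]
      onto_arrival_0[of X, OF X] onto_arrival_0[of Y, OF Y]
      onto_arrival_less[of X, OF X] onto_arrival_less[of Y, OF Y] dev' by blast
  have "\<Delta> 0 = 0"
    using \<Delta>(3)[of 0] onto_arrival_0[of X, OF X] onto_arrival_0[of Y, OF Y] by simp
  have "step_path (arrival Y \<omega>) (\<lambda>l. z (arrival X \<omega> l)) (\<Delta> s) = z s"
    if s: "s \<in> {0..<arrival X \<omega> L}" for s
  proof -
    define l where "l = X s \<omega>"
    have l: "l < L"
      using s onto_arrival_le_iff[of X, OF X, of s L] by (auto simp: l_def)
    have le: "arrival X \<omega> l \<le> s" "s < arrival X \<omega> (Suc l)"
      using s onto_arrival_le_iff[of X, OF X, of s l] onto_arrival_le_iff[of X, OF X, of s "Suc l"]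
      by (auto simp: l_def)
    have "arrival Y \<omega> l \<le> \<Delta> s"
      using monoD[OF strict_mono_mono[OF \<Delta>(1)] le(1)] \<Delta>(3)[of l] l by simp
    moreover have "\<Delta> s < arrival Y \<omega> (Suc l)"
      using strict_monoD[OF \<Delta>(1) le(2)] \<Delta>(3)[of "Suc l"] l by simp
    moreover have "0 \<le> \<Delta> s"
      using monoD[OF strict_mono_mono[OF \<Delta>(1)], of 0 s] s \<open>\<Delta> 0 = 0\<close> by simp
    ultimately have "Y (\<Delta> s) \<omega> = l"
      using onto_arrival_le_iff[of Y, OF Y, of "\<Delta> s" l]
        onto_arrival_le_iff[of Y, OF Y, of "\<Delta> s" "Suc l"] by simp
    then have "step_path (arrival Y \<omega>) (\<lambda>l. z (arrival X \<omega> l)) (\<Delta> s) = z (arrival X \<omega> l)"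
      using step_path_arrival[of Y, OF Y \<open>0 \<le> \<Delta> s\<close>] by simp
    also have "\<dots> = z s" using z[of s] s by (simp add: l_def)
    finally show ?thesis .
  qed
  then show ?thesis
    using near_identity_time_change[OF \<Delta>(1,2) \<open>\<Delta> 0 = 0\<close> \<Delta>(4)] \<Delta>(4) by blast
qed

text \<open>Agreement before \<open>\<tau>\<close> makes the first \<open>K\<close> terms of the series vanish, and the remaining weights
  sum to \<open>2\<^sup>-\<^sup>K\<close>.\<close>

lemma dJ1_le_if_agree:
  assumes \<Delta>: "\<Delta> \<in> time_changes" and agree: "\<And>s. s \<in> {0..<\<tau>} \<Longrightarrow> y (\<Delta> s) = z s"
    and dev: "\<And>s. 0 \<le> s \<Longrightarrow> \<bar>\<Delta> s - s\<bar> \<le> m" and c: "\<And>k. k \<in> {1..K} \<Longrightarrow> c k < \<tau>"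
  shows "dJ1 c y z \<le> ennreal (max ((1/2) ^ K) m)"
proof -
  let ?S = "\<lambda>k. SUP s\<in>{0..c (Suc k)}. ennreal (discrete_dist (y (\<Delta> s)) (z s))"
  have S0: "?S k = 0" if "k < K" for k
  proof -
    have "ennreal (discrete_dist (y (\<Delta> s)) (z s)) = 0" if "s \<in> {0..c (Suc k)}" for s
      using that c[of "Suc k"] agree[of s] \<open>k < K\<close> by (simp add: discrete_dist_def)
    then have "?S k \<le> 0"
      by (intro SUP_least) simp
    then show ?thesis by simp
  qed
  have S1: "?S k \<le> 1" for k
    by (rule SUP_least) (simp add: discrete_dist_def)
  have "(\<Sum>k. ennreal ((1/2) ^ Suc k) * ?S k)
      = (\<Sum>k. ennreal ((1/2) ^ Suc (k + K)) * ?S (k + K))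
        + (\<Sum>k<K. ennreal ((1/2) ^ Suc k) * ?S k)"
    by (rule suminf_offset) simp
  also have "\<dots> = (\<Sum>k. ennreal ((1/2) ^ Suc (k + K)) * ?S (k + K))"
    by (simp add: S0)
  also have "\<dots> \<le> (\<Sum>k. ennreal ((1/2) ^ Suc (k + K)))"
    using S1 by (intro suminf_le) (auto intro: mult_left_le)
  also have "\<dots> = ennreal ((1/2) ^ K)"
  proof (rule suminf_ennreal_eq)
    have "(\<lambda>k. (1/2) ^ K * (1/2) ^ Suc k) sums ((1/2) ^ K * (1::real))"
      by (intro sums_mult power_half_series)
    then show "(\<lambda>k. (1/2::real) ^ Suc (k + K)) sums (1/2) ^ K"
      by (simp add: power_add mult_ac)
  qed simp
  finally have sum: "(\<Sum>k. ennreal ((1/2) ^ Suc k) * ?S k) \<le> ennreal (max ((1/2) ^ K) m)"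
    by (rule order_trans) (simp add: ennreal_leI)
  have "(SUP s\<in>{0..}. ennreal \<bar>\<Delta> s - s\<bar>) \<le> ennreal (max ((1/2) ^ K) m)"
    using dev by (intro SUP_least ennreal_leI) (auto simp: le_max_iff_disj)
  then show ?thesis
    unfolding dJ1_def using sum by (intro INF_lower2[OF \<Delta>] max.boundedI)
qed

section \<open>Superpositions of independent Poisson processes\<close>

lemma poisson_process_counting_path:
  "poisson_process M r X \<Longrightarrow> \<omega> \<in> space M \<Longrightarrow> counting_path (\<lambda>t. X t \<omega>)"
  by (auto simp: poisson_process_def counting_path_def)

lemma poisson_pmf_generating_function:
  assumes r: "0 < r" and z: "0 \<le> z"
  shows "(\<integral>\<^sup>+k. ennreal (z ^ k) \<partial>poisson_pmf r) = ennreal (exp (r * (z - 1)))"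
proof -
  have "(\<integral>\<^sup>+k. ennreal (z ^ k) \<partial>poisson_pmf r)
      = (\<Sum>k. ennreal (exp (- r) * ((r * z) ^ k / fact k)))"
    using r z
    by (simp add: nn_integral_measure_pmf nn_integral_count_space_nat power_mult_distrib mult_ac
        flip: ennreal_mult')
  also have "\<dots> = ennreal (exp (- r) * exp (r * z))"
  proof (rule suminf_ennreal_eq)
    show "(\<lambda>k. exp (- r) * ((r * z) ^ k / fact k)) sums (exp (- r) * exp (r * z))"
      using exp_converges[of "r * z"] by (intro sums_mult) (simp add: field_simps)
  qed (use r z in simp)
  finally show ?thesis
    by (simp add: algebra_simps flip: exp_add)
qed

lemma process_events_increment:
  assumes s: "0 \<le> s" and t: "0 \<le> t"
  shows "(\<lambda>\<omega>. X t \<omega> - X s \<omega>) -` A \<inter> space M \<in> process_events M X"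
proof -
  let ?G = "{X t -` A \<inter> space M | t A. 0 \<le> t}"
  let ?S = "sigma (space M) ?G"
  have S: "sets ?S = process_events M X" "space ?S = space M"
    unfolding process_events_def by (subst sets_measure_of space_measure_of; auto)+
  have X: "X u \<in> ?S \<rightarrow>\<^sub>M count_space UNIV" if "0 \<le> u" for u
  proof (rule measurableI)
    fix B show "X u -` B \<inter> space ?S \<in> sets ?S"
      unfolding S process_events_def using that by (intro sigma_sets.Basic) blast
  qed simp
  have "(\<lambda>\<omega>. X t \<omega> - X s \<omega>) \<in> ?S \<rightarrow>\<^sub>M count_space UNIV"
    using X[OF t] X[OF s] by measurable
  then have "(\<lambda>\<omega>. X t \<omega> - X s \<omega>) -` A \<inter> space ?S \<in> sets ?S"
    by (rule measurable_sets) simp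
  then show ?thesis
    by (simp only: S)
qed

text \<open>At the first grid point at which the path has reached \<open>l\<close> it is already above \<open>l\<close>, and at the
  grid point before it was below. For a Poisson process a given one of \<open>m\<close> cells has an increment of
  at least 2 with probability \<open>O(1 / m\<^sup>2)\<close>, so some cell has one with probability \<open>O(1 / m)\<close>; letting
  \<open>m\<close> grow shows that almost surely no value is skipped.\<close>

lemma counting_path_skip_increment:
  assumes f: "counting_path f" and T: "0 < T" and skip: "\<And>t. 0 \<le> t \<Longrightarrow> f t \<noteq> l" and l: "l \<le> f T"
    and m: "0 < m"
  shows "\<exists>i<m. 2 \<le> f (T * real (Suc i) / real m) - f (T * real i / real m)"
proof -
  let ?g = "\<lambda>i. f (T * real i / real m)"
  have "\<not> l \<le> ?g 0"
    using f skip[of 0] by (auto simp: counting_path_def)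
  moreover have "l \<le> ?g m" using l m by simp
  ultimately obtain i where i: "i < m" "\<not> l \<le> ?g i" "l \<le> ?g (Suc i)"
    using ex_least_nat_less[of "\<lambda>i. l \<le> ?g i" m] by auto
  moreover have "?g (Suc i) \<noteq> l"
    using T by (intro skip) auto
  ultimately show ?thesis
    by (intro exI[of _ i]) auto
qed

locale independent_poisson_processes = prob_space M
  for M :: "'a measure" +
  fixes I :: "'i set" and X :: "'i \<Rightarrow> real \<Rightarrow> 'a \<Rightarrow> nat" and r :: "'i \<Rightarrow> real"
  assumes finite_index: "finite I" and index_nonempty: "I \<noteq> {}"
    and poisson: "\<And>i. i \<in> I \<Longrightarrow> poisson_process M (r i) (X i)"
    and indep: "indep_sets (\<lambda>i. process_events M (X i)) I"
begin

definition total :: "real \<Rightarrow> 'a \<Rightarrow> nat" where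
  "total t \<omega> = (\<Sum>i\<in>I. X i t \<omega>)"

definition rate :: real where
  "rate = (\<Sum>i\<in>I. r i)"

lemma rate_pos: "0 < rate"
  unfolding rate_def using finite_index index_nonempty poisson
  by (intro sum_pos) (auto simp: poisson_process_def)

lemma measurable_total:
  assumes "0 \<le> t"
  shows "total t \<in> M \<rightarrow>\<^sub>M count_space UNIV"
  unfolding total_def[abs_def] using poisson assms
  by (intro measurable_sum_nat) (auto simp: poisson_process_def)

lemma counting_path_total: "\<omega> \<in> space M \<Longrightarrow> counting_path (\<lambda>t. total t \<omega>)"
  unfolding total_def by (intro counting_path_sum poisson_process_counting_path[OF poisson])

text \<open>Together with Markov's inequality, the generating function of the increments gives every
  distributional fact about superpositions that is needed.\<close>

lemma total_generating_function:
  assumes s: "0 \<le> s" "s < t" and z: "0 \<le> z"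
  shows "(\<integral>\<^sup>+\<omega>. ennreal (z ^ (total t \<omega> - total s \<omega>)) \<partial>M) = ennreal (exp (rate * (t - s) * (z - 1)))"
proof -
  let ?D = "\<lambda>i \<omega>. X i t \<omega> - X i s \<omega>"
  have meas: "?D i \<in> M \<rightarrow>\<^sub>M count_space UNIV" if "i \<in> I" for i
  proof -
    have [measurable]: "X i t \<in> M \<rightarrow>\<^sub>M count_space UNIV" "X i s \<in> M \<rightarrow>\<^sub>M count_space UNIV"
      using poisson[OF that] s by (auto simp: poisson_process_def)
    show ?thesis by measurable
  qed
  have "indep_vars (\<lambda>_. count_space UNIV) ?D I"
    unfolding indep_vars_def2
  proof (intro conjI ballI meas)
    show "indep_sets (\<lambda>i. {?D i -` A \<inter> space M |A. A \<in> sets (count_space UNIV)}) I"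
      using s by (intro indep_sets_mono_sets[OF indep]) (auto intro: process_events_increment)
  qed
  then have ind: "indep_vars (\<lambda>_. borel) (\<lambda>i \<omega>. ennreal (z ^ ?D i \<omega>)) I"
    by (rule indep_vars_compose2[where Y = "\<lambda>_ k. ennreal (z ^ k)"]) simp
  have "total t \<omega> - total s \<omega> = (\<Sum>i\<in>I. ?D i \<omega>)" if "\<omega> \<in> space M" for \<omega>
    unfolding total_def
    using s counting_path_mono[OF poisson_process_counting_path[OF poisson that]]
    by (intro sum_subtractf_nat[symmetric]) auto
  then have "(\<integral>\<^sup>+\<omega>. ennreal (z ^ (total t \<omega> - total s \<omega>)) \<partial>M)
      = (\<integral>\<^sup>+\<omega>. (\<Prod>i\<in>I. ennreal (z ^ ?D i \<omega>)) \<partial>M)"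
    using z by (intro nn_integral_cong) (simp add: power_sum prod_ennreal)
  also have "\<dots> = (\<Prod>i\<in>I. \<integral>\<^sup>+\<omega>. ennreal (z ^ ?D i \<omega>) \<partial>M)"
    by (intro indep_vars_nn_integral finite_index ind) simp
  also have "\<dots> = (\<Prod>i\<in>I. ennreal (exp (r i * (t - s) * (z - 1))))"
  proof (rule prod.cong[OF refl])
    fix i assume i: "i \<in> I"
    have "(\<integral>\<^sup>+\<omega>. ennreal (z ^ ?D i \<omega>) \<partial>M)
        = (\<integral>\<^sup>+k. ennreal (z ^ k) \<partial>distr M (count_space UNIV) (?D i))"
      by (subst nn_integral_distr) (auto intro: meas[OF i])
    also have "distr M (count_space UNIV) (?D i) = measure_pmf (poisson_pmf (r i * (t - s)))"
      using poisson[OF i] s by (auto simp: poisson_process_def)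
    finally show "(\<integral>\<^sup>+\<omega>. ennreal (z ^ ?D i \<omega>) \<partial>M) = ennreal (exp (r i * (t - s) * (z - 1)))"
      using poisson[OF i] s z
      by (simp add: poisson_pmf_generating_function poisson_process_def)
  qed
  also have "\<dots> = ennreal (exp (rate * (t - s) * (z - 1)))"
    using finite_index by (simp add: prod_ennreal rate_def sum_distrib_right exp_sum)
  finally show ?thesis .
qed

lemma total_upper_tail:
  assumes s: "0 \<le> s" "s < t" and z: "1 \<le> z"
  shows "prob {\<omega> \<in> space M. k \<le> total t \<omega> - total s \<omega>} \<le> exp (rate * (t - s) * (z - 1)) / z ^ k"
proof -
  have [measurable]: "total t \<in> M \<rightarrow>\<^sub>M count_space UNIV" "total s \<in> M \<rightarrow>\<^sub>M count_space UNIV"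
    using s by (auto intro: measurable_total)
  have "emeasure M {\<omega> \<in> space M. k \<le> total t \<omega> - total s \<omega>}
      \<le> emeasure M {\<omega> \<in> space M. 1 \<le> ennreal (1 / z ^ k) * ennreal (z ^ (total t \<omega> - total s \<omega>))}"
  proof (intro emeasure_mono subsetI CollectI conjI; clarsimp)
    fix \<omega> assume "k \<le> total t \<omega> - total s \<omega>"
    then have "z ^ k \<le> z ^ (total t \<omega> - total s \<omega>)"
      using z by (intro power_increasing) auto
    then show "1 \<le> ennreal (1 / z ^ k) * ennreal (z ^ (total t \<omega> - total s \<omega>))"
      using z by (simp add: field_simps flip: ennreal_mult)
  qed
  also have "\<dots> \<le> ennreal (1 / z ^ k)
      * (\<integral>\<^sup>+\<omega>. ennreal (z ^ (total t \<omega> - total s \<omega>)) * indicator (space M) \<omega> \<partial>M)"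
    by (rule nn_integral_Markov_inequality) measurable
  also have "(\<integral>\<^sup>+\<omega>. ennreal (z ^ (total t \<omega> - total s \<omega>)) * indicator (space M) \<omega> \<partial>M)
      = ennreal (exp (rate * (t - s) * (z - 1)))"
    using s z by (subst total_generating_function[symmetric]) (auto intro!: nn_integral_cong)
  also have "ennreal (1 / z ^ k) * \<dots> = ennreal (exp (rate * (t - s) * (z - 1)) / z ^ k)"
    using z by (simp flip: ennreal_mult)
  finally show ?thesis
    using z by (simp add: emeasure_eq_measure)
qed

lemma total_lower_tail:
  assumes t: "0 < t"
  shows "prob {\<omega> \<in> space M. total t \<omega> \<le> k} \<le> 2 ^ k * exp (- rate * t / 2)"
proof -
  have [measurable]: "total t \<in> M \<rightarrow>\<^sub>M count_space UNIV"
    using t by (auto intro: measurable_total)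
  have "emeasure M {\<omega> \<in> space M. total t \<omega> \<le> k}
      \<le> emeasure M {\<omega> \<in> space M. 1 \<le> ennreal (2 ^ k) * ennreal ((1/2) ^ total t \<omega>)}"
  proof (intro emeasure_mono subsetI CollectI conjI; clarsimp)
    fix \<omega> assume "total t \<omega> \<le> k"
    then have "(2::real) ^ total t \<omega> \<le> 2 ^ k" by simp
    then have "(1::real) \<le> 2 ^ k * (1/2) ^ total t \<omega>"
      by (simp add: power_divide)
    then show "1 \<le> ennreal (2 ^ k) * ennreal ((1/2) ^ total t \<omega>)"
      by (metis ennreal_1 ennreal_leI ennreal_mult' zero_le_numeral zero_le_power)
  qed
  also have "\<dots> \<le> ennreal (2 ^ k) * (\<integral>\<^sup>+\<omega>. ennreal ((1/2) ^ total t \<omega>) * indicator (space M) \<omega> \<partial>M)"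
    by (rule nn_integral_Markov_inequality) measurable
  also have "(\<integral>\<^sup>+\<omega>. ennreal ((1/2) ^ total t \<omega>) * indicator (space M) \<omega> \<partial>M)
      = (\<integral>\<^sup>+\<omega>. ennreal ((1/2) ^ (total t \<omega> - total 0 \<omega>)) \<partial>M)"
    using counting_path_total by (intro nn_integral_cong) (simp add: counting_path_def)
  also have "\<dots> = ennreal (exp (- rate * t / 2))"
    using t by (subst total_generating_function) auto
  also have "ennreal (2 ^ k) * \<dots> = ennreal (2 ^ k * exp (- rate * t / 2))"
    by (simp flip: ennreal_mult)
  finally show ?thesis
    by (simp add: emeasure_eq_measure)
qed

lemma AE_total_unbounded: "AE \<omega> in M. \<forall>l. \<exists>t\<ge>0. l \<le> total t \<omega>"
  unfolding AE_all_countable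
proof
  fix l
  define A where "A j = {\<omega> \<in> space M. total (real (Suc j)) \<omega> \<le> l}" for j
  have A [measurable]: "A j \<in> sets M" for j
    unfolding A_def using measurable_total[of "real (Suc j)"] by measurable
  have "emeasure M (\<Inter>j. A j) \<le> ennreal (2 ^ l * exp (- rate * real (Suc j) / 2))" for j
  proof -
    have "emeasure M (\<Inter>j. A j) \<le> emeasure M (A j)"
      by (intro emeasure_mono) auto
    also have "\<dots> \<le> ennreal (2 ^ l * exp (- rate * real (Suc j) / 2))"
      using total_lower_tail[of "real (Suc j)" l]
      unfolding A_def emeasure_eq_measure by (intro ennreal_leI) auto
    finally show ?thesis .
  qed
  moreover have "(\<lambda>j. 2 ^ l * exp (- rate * real (Suc j) / 2)) \<longlonglongrightarrow> 0"
  proof -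
    have "(\<lambda>j. K * exp (- c * real (Suc j) / 2)) \<longlonglongrightarrow> 0" if "0 < c" for K c :: real
      using that by real_asymp
    then show ?thesis using rate_pos by blast
  qed
  ultimately have "emeasure M (\<Inter>j. A j) \<le> ennreal 0"
    by (intro LIMSEQ_le_const[OF tendsto_ennrealI]) blast+
  then have "AE \<omega> in M. \<omega> \<notin> (\<Inter>j. A j)"
    by (intro AE_not_in) (auto simp: null_sets_def)
  then show "AE \<omega> in M. \<exists>t\<ge>0. l \<le> total t \<omega>"
  proof (rule AE_mp, intro AE_I2 impI)
    fix \<omega> assume "\<omega> \<in> space M" "\<omega> \<notin> (\<Inter>j. A j)"
    then obtain j where "\<omega> \<notin> A j" by blast
    then have "l < total (real (Suc j)) \<omega>"
      using \<open>\<omega> \<in> space M\<close> by (simp add: A_def)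
    then show "\<exists>t\<ge>0. l \<le> total t \<omega>"
      by (intro exI[of _ "real (Suc j)"]) auto
  qed
qed

lemma AE_total_no_skip: "AE \<omega> in M. \<forall>l. l \<le> total (real (Suc j)) \<omega> \<longrightarrow> (\<exists>t\<ge>0. total t \<omega> = l)"
proof -
  define T where "T = real (Suc j)"
  have T: "0 < T" by (simp add: T_def)
  \<comment> \<open>\<open>B m\<close>, the event that some of \<open>m\<close> cells has an increment of at least 2, is a measurable cover of
    the event that a value is skipped.\<close>
  define D where "D m i = {\<omega> \<in> space M.
      2 \<le> total (T * real (Suc i) / real m) \<omega> - total (T * real i / real m) \<omega>}" for m i
  define B where "B m = (\<Union>i<m. D m i)" for m
  define mu where "mu m = rate * T / real m" for m
  have D [measurable]: "D m i \<in> sets M" for m i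
  proof -
    have [measurable]: "total (T * real (Suc i) / real m) \<in> M \<rightarrow>\<^sub>M count_space UNIV"
      "total (T * real i / real m) \<in> M \<rightarrow>\<^sub>M count_space UNIV"
      using T by (auto intro!: measurable_total)
    show ?thesis unfolding D_def by measurable
  qed
  have B [measurable]: "B m \<in> sets M" for m
    unfolding B_def by auto
  have prob_D: "prob (D m i) \<le> exp 1 * (mu m)\<^sup>2" if m: "0 < m" "rate * T \<le> real m" for m i
  proof -
    \<comment> \<open>For a Poisson mean \<open>mu m \<le> 1\<close> the choice \<open>z = 1 / mu m\<close> is nearly optimal in the Chernoff bound.\<close>
    have mu: "0 < mu m" "mu m \<le> 1"
      using rate_pos T m by (auto simp: mu_def)
    have step: "rate * (T * real (Suc i) / real m - T * real i / real m) = mu m"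
      by (simp add: mu_def field_simps add_divide_distrib)
    have "prob (D m i) \<le> exp (mu m * (1 / mu m - 1)) / (1 / mu m) ^ 2"
      using total_upper_tail[of "T * real i / real m" "T * real (Suc i) / real m" "1 / mu m" 2] T m mu
      unfolding D_def step by (simp add: divide_strict_right_mono)
    also have "\<dots> = exp (1 - mu m) * (mu m)\<^sup>2"
      using mu by (simp add: algebra_simps power_divide)
    also have "\<dots> \<le> exp 1 * (mu m)\<^sup>2"
      using mu by (intro mult_right_mono) auto
    finally show ?thesis .
  qed
  have prob_B: "emeasure M (B m) \<le> ennreal (exp 1 * (rate * T)\<^sup>2 / real m)"
    if m: "0 < m" "rate * T \<le> real m" for m
  proof -
    have "prob (B m) \<le> (\<Sum>i<m. prob (D m i))"
      unfolding B_def by (rule finite_measure_subadditive_finite) auto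
    also have "\<dots> \<le> (\<Sum>i<m. exp 1 * (mu m)\<^sup>2)"
      by (intro sum_mono prob_D m)
    also have "\<dots> = exp 1 * (rate * T)\<^sup>2 / real m"
      using m by (simp add: mu_def power2_eq_square field_simps)
    finally show ?thesis
      unfolding emeasure_eq_measure by (rule ennreal_leI)
  qed
  have ev: "\<forall>\<^sub>F m in sequentially. emeasure M (\<Inter>m. B (Suc m)) \<le> ennreal (exp 1 * (rate * T)\<^sup>2 / real m)"
    using eventually_gt_at_top[of 0] eventually_ge_at_top[of "nat \<lceil>rate * T\<rceil>"]
  proof eventually_elim
    case (elim m)
    have "emeasure M (\<Inter>m. B (Suc m)) \<le> emeasure M (B m)"
      using elim(1) by (intro emeasure_mono) (auto dest: INT_D[where a = "m - 1"])
    also have "\<dots> \<le> ennreal (exp 1 * (rate * T)\<^sup>2 / real m)"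
      using elim by (intro prob_B) linarith+
    finally show ?case .
  qed
  have "(\<lambda>m. exp 1 * (rate * T)\<^sup>2 / real m) \<longlonglongrightarrow> 0"
    by (rule lim_const_over_n)
  then have "(\<lambda>m. ennreal (exp 1 * (rate * T)\<^sup>2 / real m)) \<longlonglongrightarrow> ennreal 0"
    by (rule tendsto_ennrealI)
  then have "emeasure M (\<Inter>m. B (Suc m)) \<le> ennreal 0"
    using ev by (rule tendsto_lowerbound) simp
  then have "AE \<omega> in M. \<omega> \<notin> (\<Inter>m. B (Suc m))"
    by (intro AE_not_in) (auto simp: null_sets_def)
  then show ?thesis
  proof (rule AE_mp, intro AE_I2 impI allI)
    fix \<omega> l assume \<omega>: "\<omega> \<in> space M" "\<omega> \<notin> (\<Inter>m. B (Suc m))" and l: "l \<le> total (real (Suc j)) \<omega>"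
    show "\<exists>t\<ge>0. total t \<omega> = l"
    proof (rule ccontr)
      assume "\<not> (\<exists>t\<ge>0. total t \<omega> = l)"
      then have "\<omega> \<in> B (Suc m)" for m
        using counting_path_skip_increment[OF counting_path_total[OF \<omega>(1)] T, of l "Suc m"] l \<omega>(1)
        by (auto simp: B_def D_def T_def)
      then show False using \<omega>(2) by simp
    qed
  qed
qed

lemma AE_onto_counting_path_total: "AE \<omega> in M. onto_counting_path (\<lambda>t. total t \<omega>)"
proof -
  have "AE \<omega> in M. \<forall>j l. l \<le> total (real (Suc j)) \<omega> \<longrightarrow> (\<exists>t\<ge>0. total t \<omega> = l)"
    using AE_total_no_skip by (simp add: AE_all_countable)
  then show ?thesis
    using AE_total_unbounded
  proof (rule AE_mp[OF _ AE_mp], intro AE_I2 impI)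
    fix \<omega> assume \<omega>: "\<omega> \<in> space M" and unb: "\<forall>l. \<exists>t\<ge>0. l \<le> total t \<omega>"
      and skip: "\<forall>j l. l \<le> total (real (Suc j)) \<omega> \<longrightarrow> (\<exists>t\<ge>0. total t \<omega> = l)"
    have "\<exists>t\<ge>0. total t \<omega> = l" for l
    proof -
      obtain t where t: "0 \<le> t" "l \<le> total t \<omega>" using unb by blast
      have "total t \<omega> \<le> total (real (Suc (nat \<lceil>t\<rceil>))) \<omega>"
        using t by (intro counting_path_mono[OF counting_path_total[OF \<omega>]]) linarith+
      then show ?thesis using skip t(2) order_trans by blast
    qed
    then show "onto_counting_path (\<lambda>t. total t \<omega>)"
      using counting_path_total[OF \<omega>] by (simp add: onto_counting_path_def)
  qed
qed

end

text \<open>The tail event on the deviations of arrival times must be measurable for its \<^const>\<open>measure\<close> to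
  carry information, since a nonmeasurable set has measure 0 by convention. Where the path never reaches \<open>l\<close>, the arrival time is the constant \<open>Inf {}\<close>.\<close>

lemma measurable_arrival:
  assumes meas: "\<And>t. 0 \<le> t \<Longrightarrow> X t \<in> M \<rightarrow>\<^sub>M count_space UNIV"
    and path: "\<And>\<omega>. \<omega> \<in> space M \<Longrightarrow> counting_path (\<lambda>t. X t \<omega>)"
  shows "(\<lambda>\<omega>. arrival X \<omega> l) \<in> borel_measurable M"
  unfolding borel_measurable_iff_le
proof
  fix a :: real
  have [measurable]: "X (real j) \<in> M \<rightarrow>\<^sub>M count_space UNIV" for j
    by (intro meas) simp
  let ?R = "{\<omega> \<in> space M. \<exists>j. l \<le> X (real j) \<omega>}"
  have R: "?R \<in> sets M" by measurable
  have reach: "(\<exists>t\<ge>0. l \<le> X t \<omega>) \<longleftrightarrow> (\<exists>j. l \<le> X (real j) \<omega>)" if "\<omega> \<in> space M" for \<omega>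
  proof
    assume "\<exists>t\<ge>0. l \<le> X t \<omega>"
    then obtain t where t: "0 \<le> t" "l \<le> X t \<omega>" by blast
    have "X t \<omega> \<le> X (real (nat \<lceil>t\<rceil>)) \<omega>"
      using t by (intro counting_path_mono[OF path[OF that]]) linarith+
    then show "\<exists>j. l \<le> X (real j) \<omega>" using t(2) order_trans by blast
  next
    assume "\<exists>j. l \<le> X (real j) \<omega>"
    then show "\<exists>t\<ge>0. l \<le> X t \<omega>" by (metis of_nat_0_le_iff)
  qed
  have "{\<omega> \<in> space M. arrival X \<omega> l \<le> a} =
      (if 0 \<le> a then {\<omega> \<in> space M. l \<le> X a \<omega>} \<inter> ?R else {}) \<union>
      (if Inf ({} :: real set) \<le> a then space M - ?R else {})"
  proof (intro set_eqI)
    fix \<omega>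
    show "\<omega> \<in> {\<omega> \<in> space M. arrival X \<omega> l \<le> a} \<longleftrightarrow> \<omega> \<in>
      (if 0 \<le> a then {\<omega> \<in> space M. l \<le> X a \<omega>} \<inter> ?R else {}) \<union>
      (if Inf ({} :: real set) \<le> a then space M - ?R else {})"
    proof (cases "\<omega> \<in> space M \<and> (\<exists>t\<ge>0. l \<le> X t \<omega>)")
      case True
      then have "0 \<le> arrival X \<omega> l" by (intro arrival_nonneg) auto
      moreover have "arrival X \<omega> l \<le> a \<longleftrightarrow> l \<le> X a \<omega>" if "0 \<le> a"
        using True that by (intro arrival_le_iff path) auto
      ultimately show ?thesis
        using True reach[of \<omega>] by auto
    next
      case False
      then have "arrival X \<omega> l = Inf {}" if "\<omega> \<in> space M"
        using that unfolding arrival_def by (intro arg_cong[where f = Inf]) auto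
      then show ?thesis
        using False reach[of \<omega>] by auto
    qed
  qed
  also have "\<dots> \<in> sets M"
    using R meas[of a] by (cases "0 \<le> a") (auto intro!: sets.Un sets.Int)
  finally show "{\<omega> \<in> space M. arrival X \<omega> l \<le> a} \<in> sets M" .
qed

lemma (in prob_space) indep_sets_reindex:
  assumes inj: "inj_on h I" and ind: "indep_sets F (h ` I)"
  shows "indep_sets (\<lambda>i. F (h i)) I"
proof (rule indep_setsI)
  show "F (h i) \<subseteq> events" if "i \<in> I" for i
    using ind that by (auto simp: indep_sets_def)
next
  fix A K assume K: "K \<noteq> {}" "K \<subseteq> I" "finite K" "\<forall>j\<in>K. A j \<in> F (h j)"
  have inv: "inv_into I h (h j) = j" if "j \<in> K" for j
    using inj K(2) that by (intro inv_into_f_f) auto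
  have "prob (\<Inter>j\<in>h ` K. A (inv_into I h j)) = (\<Prod>j\<in>h ` K. prob (A (inv_into I h j)))"
    using K inv by (intro indep_setsD[OF ind]) auto
  moreover have "inj_on h K"
    using inj K(2) by (rule inj_on_subset)
  ultimately show "prob (\<Inter>j\<in>K. A j) = (\<Prod>j\<in>K. prob (A j))"
    using inv by (simp add: prod.reindex)
qed

text \<open>One half of the driving noise: the process \<open>X\<close> and the increments that raise its intensity. The
  family \<open>E\<close> holds the events of both halves, and \<open>h\<close> picks out those of this half, with index \<open>l0\<close>
  standing for \<open>X\<close> itself.\<close>

locale independent_superposition = prob_space P
  for P :: "'w measure" +
  fixes l0 :: nat and X :: "real \<Rightarrow> 'w \<Rightarrow> nat" and Xh :: "nat \<Rightarrow> real \<Rightarrow> 'w \<Rightarrow> nat"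
    and E :: "'c \<Rightarrow> 'w set set" and h :: "nat \<Rightarrow> 'c"
  assumes base: "poisson_process P (real l0) X"
    and increments: "\<And>k. l0 + 1 \<le> k \<Longrightarrow> poisson_process P 1 (Xh k)"
    and inj: "inj_on h {l0..}"
    and indep: "indep_sets E (h ` {l0..})"
    and events_base: "E (h l0) = process_events P X"
    and events_increments: "\<And>k. l0 + 1 \<le> k \<Longrightarrow> E (h k) = process_events P (Xh k)"
begin

definition layer :: "nat \<Rightarrow> real \<Rightarrow> 'w \<Rightarrow> nat" where
  "layer k = (if k = l0 then X else Xh k)"

definition layer_rate :: "nat \<Rightarrow> real" where
  "layer_rate k = (if k = l0 then real l0 else 1)"

lemma layers_independent_poisson:
  assumes n: "l0 \<le> n"
  shows "independent_poisson_processes P {l0..n} layer layer_rate"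
proof unfold_locales
  show "poisson_process P (layer_rate k) (layer k)" if "k \<in> {l0..n}" for k
    using that base increments[of k] by (auto simp: layer_def layer_rate_def)
  have "indep_sets (\<lambda>k. E (h k)) {l0..n}"
    by (rule indep_sets_reindex) (use inj indep in \<open>auto intro: inj_on_subset indep_sets_mono_index[rotated]\<close>)
  then show "indep_sets (\<lambda>k. process_events P (layer k)) {l0..n}"
    by (rule indep_sets_mono_sets)
      (use events_base events_increments in \<open>auto simp: layer_def Suc_le_eq\<close>)
qed (use n in auto)

lemma layers_total:
  assumes n: "l0 \<le> n"
  shows "independent_poisson_processes.total {l0..n} layer = superposition l0 X Xh n"
proof (intro ext)
  fix t \<omega>
  have "(\<Sum>k=l0+1..n. layer k t \<omega>) = (\<Sum>k=l0+1..n. Xh k t \<omega>)"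
    by (intro sum.cong) (auto simp: layer_def)
  then show "independent_poisson_processes.total {l0..n} layer t \<omega> = superposition l0 X Xh n t \<omega>"
    using n by (simp add: independent_poisson_processes.total_def[OF layers_independent_poisson[OF n]]
        superposition_def sum.atLeast_Suc_atMost[of l0 n] layer_def)
qed

lemma layers_rate:
  assumes n: "l0 \<le> n"
  shows "independent_poisson_processes.rate {l0..n} layer_rate = real n"
proof -
  have "(\<Sum>k=l0+1..n. layer_rate k) = (\<Sum>k=l0+1..n. 1)"
    by (intro sum.cong) (auto simp: layer_rate_def)
  then show ?thesis
    using n by (simp add: independent_poisson_processes.rate_def[OF layers_independent_poisson[OF n]]
        sum.atLeast_Suc_atMost[of l0 n] layer_rate_def)
qed

lemma counting_path_superposition:
  "\<omega> \<in> space P \<Longrightarrow> counting_path (\<lambda>t. superposition l0 X Xh n t \<omega>)"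
  unfolding superposition_def
  by (intro counting_path_add counting_path_sum poisson_process_counting_path[OF base]
      poisson_process_counting_path[OF increments]) auto

lemma measurable_superposition:
  assumes "0 \<le> t"
  shows "superposition l0 X Xh n t \<in> P \<rightarrow>\<^sub>M count_space UNIV"
proof -
  have [measurable]: "X t \<in> P \<rightarrow>\<^sub>M count_space UNIV"
    using base assms by (simp add: poisson_process_def)
  have [measurable]: "(\<lambda>\<omega>. \<Sum>k=l0+1..n. Xh k t \<omega>) \<in> P \<rightarrow>\<^sub>M count_space UNIV"
    using increments assms by (intro measurable_sum_nat) (auto simp: poisson_process_def)
  show ?thesis
    unfolding superposition_def[abs_def] by measurable
qed

lemma AE_onto_counting_path_superposition:
  assumes n: "l0 \<le> n"
  shows "AE \<omega> in P. onto_counting_path (\<lambda>t. superposition l0 X Xh n t \<omega>)"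
  using independent_poisson_processes.AE_onto_counting_path_total[OF layers_independent_poisson[OF n]]
  by (simp add: layers_total[OF n])

lemma superposition_upper_tail:
  assumes n: "l0 \<le> n" and t: "0 < t" and z: "1 \<le> z"
  shows "prob {\<omega> \<in> space P. k \<le> superposition l0 X Xh n t \<omega>} \<le> exp (real n * t * (z - 1)) / z ^ k"
proof -
  have "{\<omega> \<in> space P. k \<le> superposition l0 X Xh n t \<omega>}
      = {\<omega> \<in> space P. k \<le> superposition l0 X Xh n t \<omega> - superposition l0 X Xh n 0 \<omega>}"
    using counting_path_superposition[of _ n] by (auto simp: counting_path_def)
  then show ?thesis
    using independent_poisson_processes.total_upper_tail[OF layers_independent_poisson[OF n] order_refl t z, of k]
    by (simp add: layers_total[OF n] layers_rate[OF n])
qed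

text \<open>Every arrival of \<open>X\<close> is an arrival of the superposition, so \<open>X\<close> cannot move while the
  superposition stands still.\<close>

lemma superposition_level_base:
  assumes \<omega>: "\<omega> \<in> space P" and st: "0 \<le> s" "s \<le> t"
    and eq: "superposition l0 X Xh n s \<omega> = superposition l0 X Xh n t \<omega>"
  shows "X s \<omega> = X t \<omega>"
proof -
  have "X s \<omega> \<le> X t \<omega>"
    by (intro counting_path_mono[OF poisson_process_counting_path[OF base \<omega>]] st)
  moreover have "(\<Sum>k=l0+1..n. Xh k s \<omega>) \<le> (\<Sum>k=l0+1..n. Xh k t \<omega>)"
    by (intro sum_mono counting_path_mono[OF poisson_process_counting_path[OF increments \<omega>]] st) auto
  ultimately show ?thesis
    using eq by (simp add: superposition_def)
qed

end

section \<open>Resampling a step process\<close>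

text \<open>The estimates use of the jump process only that it moves at the arrival times of \<open>N\<close>, so the value
  \<open>Y \<omega> l\<close> entered at the \<open>l\<close>-th arrival is an arbitrary element of \<open>S\<close>.\<close>

locale resampled_step_process =
  nn: independent_superposition P l0 N Nh E h + mm: independent_superposition P l0 M Mh E h'
  for P :: "'w measure" and l0 :: nat and N M :: "real \<Rightarrow> 'w \<Rightarrow> nat"
    and Nh Mh :: "nat \<Rightarrow> real \<Rightarrow> 'w \<Rightarrow> nat" and E :: "'c \<Rightarrow> 'w set set" and h h' :: "nat \<Rightarrow> 'c" +
  fixes Y :: "'w \<Rightarrow> nat \<Rightarrow> 'b" and S :: "'b set"
  assumes values_in: "\<And>\<omega> l. onto_counting_path (\<lambda>t. N t \<omega>) \<Longrightarrow> Y \<omega> l \<in> S" and l0_pos: "0 < l0"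
begin

abbreviation Nn where "Nn n \<equiv> superposition l0 N Nh n"
abbreviation Mn where "Mn n \<equiv> superposition l0 M Mh n"

definition J :: "'w \<Rightarrow> real \<Rightarrow> 'b" where
  "J \<omega> = step_path (arrival N \<omega>) (Y \<omega>)"

definition Jn :: "nat \<Rightarrow> 'w \<Rightarrow> real \<Rightarrow> 'b" where
  "Jn n = approx_process J (Nn n) (Mn n)"

definition regular :: "'w \<Rightarrow> bool" where
  "regular \<omega> \<longleftrightarrow> \<omega> \<in> space P \<and> onto_counting_path (\<lambda>t. N t \<omega>) \<and>
     (\<forall>n\<ge>l0. onto_counting_path (\<lambda>t. Nn n t \<omega>) \<and> onto_counting_path (\<lambda>t. Mn n t \<omega>))"

definition sample_size :: "real \<Rightarrow> nat \<Rightarrow> nat" where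
  "sample_size \<epsilon> n = nat \<lfloor>real n powr (1 + \<epsilon>)\<rfloor>"

definition deviation :: "real \<Rightarrow> nat \<Rightarrow> 'w \<Rightarrow> real" where
  "deviation \<epsilon> n \<omega> =
     (MAX l\<in>{1..sample_size \<epsilon> n}. \<bar>arrival (Mn n) \<omega> l - arrival (Nn n) \<omega> l\<bar>)"

text \<open>The event that the compared arrival times do not extend beyond time \<open>n\<^sup>\<epsilon> / 2\<close>, about half of what
  they cover on average.\<close>

definition short_horizon :: "real \<Rightarrow> nat \<Rightarrow> 'w set" where
  "short_horizon \<epsilon> n = {\<omega> \<in> space P. sample_size \<epsilon> n \<le> Nn n (real n powr \<epsilon> / 2) \<omega>}"

lemma AE_regular: "AE \<omega> in P. regular \<omega>"
proof -
  have "AE \<omega> in P. onto_counting_path (\<lambda>t. N t \<omega>)"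
    using nn.AE_onto_counting_path_superposition[of l0] by (simp add: superposition_def)
  moreover have "AE \<omega> in P. \<forall>n\<in>{l0..}. onto_counting_path (\<lambda>t. Nn n t \<omega>)"
    by (subst AE_ball_countable) (auto intro: nn.AE_onto_counting_path_superposition)
  moreover have "AE \<omega> in P. \<forall>n\<in>{l0..}. onto_counting_path (\<lambda>t. Mn n t \<omega>)"
    by (subst AE_ball_countable) (auto intro: mm.AE_onto_counting_path_superposition)
  ultimately show ?thesis
    using AE_space by eventually_elim (auto simp: regular_def)
qed

lemma measurable_deviation: "deviation \<epsilon> n \<in> borel_measurable P"
proof -
  have [measurable]: "(\<lambda>\<omega>. arrival (Nn n) \<omega> l) \<in> borel_measurable P"
    "(\<lambda>\<omega>. arrival (Mn n) \<omega> l) \<in> borel_measurable P" for l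
    by (intro measurable_arrival nn.measurable_superposition nn.counting_path_superposition
        mm.measurable_superposition mm.counting_path_superposition; assumption)+
  show ?thesis
    unfolding deviation_def[abs_def] by measurable
qed

lemma short_horizon_sets: "short_horizon \<epsilon> n \<in> sets P"
proof -
  have [measurable]: "Nn n (real n powr \<epsilon> / 2) \<in> P \<rightarrow>\<^sub>M count_space UNIV"
    by (intro nn.measurable_superposition) simp
  show ?thesis
    unfolding short_horizon_def by measurable
qed

text \<open>With \<open>x = n powr (1 + \<epsilon>)\<close>, a Poisson variable of mean \<open>x / 2\<close> has to reach about \<open>x\<close>. The Chernoff bound
  with \<open>z = 2\<close> gives \<open>2 exp (- (ln 2 - 1/2) x)\<close>, which is small because \<open>ln 2 \<ge> 2/3\<close>.\<close>

lemma short_horizon_prob: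
  assumes \<epsilon>: "0 < \<epsilon>" and n: "l0 \<le> n"
  shows "measure P (short_horizon \<epsilon> n) \<le> 2 * exp (- real n / 6)"
proof -
  define x where "x = real n powr (1 + \<epsilon>)"
  have n1: "1 \<le> real n" using n l0_pos by simp
  then have x: "real n \<le> x"
    using \<epsilon> powr_mono[of 1 "1 + \<epsilon>" "real n"] by (simp add: x_def)
  have half: "real n * (real n powr \<epsilon> / 2) = x / 2"
    using n1 by (simp add: x_def powr_add)
  have "measure P (short_horizon \<epsilon> n) \<le> exp (real n * (real n powr \<epsilon> / 2) * (2 - 1)) / 2 ^ sample_size \<epsilon> n"
    unfolding short_horizon_def by (rule nn.superposition_upper_tail) (use n n1 in auto)
  also have "\<dots> = exp (x / 2) / 2 powr real (sample_size \<epsilon> n)"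
    unfolding half by (simp add: powr_realpow)
  also have "\<dots> \<le> exp (x / 2) / 2 powr (x - 1)"
  proof -
    have "x - 1 \<le> real (sample_size \<epsilon> n)"
      unfolding sample_size_def x_def[symmetric] using x n1 by linarith
    then show ?thesis
      by (intro divide_left_mono powr_mono) auto
  qed
  also have "\<dots> = 2 * exp (- (ln 2 - 1 / 2) * x)"
    by (simp add: powr_diff powr_def exp_diff exp_minus field_simps flip: exp_add)
  also have "\<dots> \<le> 2 * exp (- real n / 6)"
  proof -
    have "(1 / 6) * real n \<le> (ln 2 - 1 / 2) * x"
      using x n1 ln2_ge_two_thirds by (intro mult_mono) auto
    then show ?thesis by (simp add: algebra_simps)
  qed
  finally show ?thesis .
qed

lemma J_cadlag: "regular \<omega> \<Longrightarrow> J \<omega> \<in> cadlag_paths S"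
  unfolding J_def regular_def by (intro step_path_cadlag values_in) auto

text \<open>Between arrivals of \<open>Nn n\<close> the process \<open>N\<close> stands still, so \<open>J\<close> is determined by its values at
  these arrivals.\<close>

lemma J_resampled:
  assumes reg: "regular \<omega>" and n: "l0 \<le> n" and s: "0 \<le> s"
  shows "J \<omega> s = J \<omega> (arrival (Nn n) \<omega> (Nn n s \<omega>))"
proof -
  have onto: "onto_counting_path (\<lambda>t. N t \<omega>)" "onto_counting_path (\<lambda>t. Nn n t \<omega>)" "\<omega> \<in> space P"
    using reg n by (auto simp: regular_def)
  let ?a = "arrival (Nn n) \<omega> (Nn n s \<omega>)"
  have a: "0 \<le> ?a" "?a \<le> s" "Nn n ?a \<omega> = Nn n s \<omega>"
    using onto_arrival_nonneg[of "Nn n", OF onto(2)] onto_arrival_le_iff[of "Nn n", OF onto(2) s]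
      count_at_arrival[of "Nn n", OF onto(2)] by auto
  have "N ?a \<omega> = N s \<omega>"
    by (rule nn.superposition_level_base[OF onto(3) a])
  then show ?thesis
    unfolding J_def
    using step_path_arrival[of N, OF onto(1) s, of "Y \<omega>"]
      step_path_arrival[of N, OF onto(1) a(1), of "Y \<omega>"] by simp
qed

lemma Jn_cadlag:
  assumes reg: "regular \<omega>" and n: "l0 \<le> n"
  shows "Jn n \<omega> \<in> cadlag_paths S"
proof -
  have onto: "onto_counting_path (\<lambda>t. Nn n t \<omega>)" "onto_counting_path (\<lambda>t. Mn n t \<omega>)"
    using reg n by (auto simp: regular_def)
  have "J \<omega> (arrival (Nn n) \<omega> l) \<in> S" for l
    using J_cadlag[OF reg] onto_arrival_nonneg[of "Nn n", OF onto(1)] by (auto simp: cadlag_paths_def)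
  then show ?thesis
    unfolding Jn_def approx_process_def by (intro step_path_cadlag onto(2))
qed

text \<open>The whole comparison of the two paths: the sampled arrival times extend beyond \<open>n\<^sup>\<epsilon> / 2\<close>, and up
  to there a time change with deviation \<open>deviation \<epsilon> n \<omega>\<close> carries one path to the other.\<close>

lemma dJ1_resampled_le:
  assumes reg: "regular \<omega>" and n: "l0 \<le> n" and \<epsilon>: "0 < \<epsilon>"
    and long: "\<omega> \<notin> short_horizon \<epsilon> n"
    and c: "\<And>k. k \<in> {1..K} \<Longrightarrow> c k \<le> real n powr \<epsilon> / 2"
  shows "dJ1 c (Jn n \<omega>) (J \<omega>) \<le> ennreal (max ((1/2) ^ K) (deviation \<epsilon> n \<omega>))"
proof -
  let ?L = "sample_size \<epsilon> n"
  have onto: "onto_counting_path (\<lambda>t. Nn n t \<omega>)" "onto_counting_path (\<lambda>t. Mn n t \<omega>)" "\<omega> \<in> space P"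
    using reg n by (auto simp: regular_def)
  have L: "1 \<in> {1..?L}"
  proof -
    have "1 \<le> real n" using n l0_pos by simp
    then have "1 \<le> real n powr (1 + \<epsilon>)" using \<epsilon> by (simp add: ge_one_powr_ge_zero)
    then show ?thesis by (simp add: sample_size_def) linarith
  qed
  have dev: "\<bar>arrival (Mn n) \<omega> l - arrival (Nn n) \<omega> l\<bar> \<le> deviation \<epsilon> n \<omega>" if "l \<in> {1..?L}" for l
    unfolding deviation_def using that by (intro Max_ge) auto
  have dev0: "0 \<le> deviation \<epsilon> n \<omega>"
    using dev[OF L] by linarith
  have Jn: "Jn n \<omega> = step_path (arrival (Mn n) \<omega>) (\<lambda>l. J \<omega> (arrival (Nn n) \<omega> l))"
    by (simp add: Jn_def approx_process_def)
  obtain \<Delta> where \<Delta>: "\<Delta> \<in> time_changes"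
    "\<And>s. s \<in> {0..<arrival (Nn n) \<omega> ?L} \<Longrightarrow> Jn n \<omega> (\<Delta> s) = J \<omega> s" "\<And>s. \<bar>\<Delta> s - s\<bar> \<le> deviation \<epsilon> n \<omega>"
    using resampled_path_time_change[where X = "Nn n" and Y = "Mn n" and \<omega> = \<omega> and L = ?L
        and m = "deviation \<epsilon> n \<omega>" and z = "J \<omega>", OF onto(1,2) dev dev0 J_resampled[OF reg n]]
    unfolding Jn by blast
  have "real n powr \<epsilon> / 2 < arrival (Nn n) \<omega> ?L"
    using long onto(3) onto_arrival_le_iff[of "Nn n", OF onto(1), of "real n powr \<epsilon> / 2" ?L]
    by (auto simp: short_horizon_def)
  then have "c k < arrival (Nn n) \<omega> ?L" if "k \<in> {1..K}" for k
    using c[OF that] by simp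
  then show ?thesis
    by (intro dJ1_le_if_agree[OF \<Delta>(1)] \<Delta>) auto
qed

context
  fixes \<delta> :: "nat \<Rightarrow> real" and q \<epsilon> :: real
  assumes \<epsilon>: "0 < \<epsilon>" and q: "0 < q"
    and dev: "(\<lambda>n. measure P {\<omega> \<in> space P. \<delta> n \<le> deviation \<epsilon> n \<omega>}) \<in> o(\<lambda>n. real n powr (- q))"
begin

definition bad :: "nat \<Rightarrow> 'w set" where
  "bad n = {\<omega> \<in> space P. \<delta> n \<le> deviation \<epsilon> n \<omega>} \<union> short_horizon \<epsilon> n"

lemma bad_sets: "bad n \<in> sets P"
proof -
  have [measurable]: "deviation \<epsilon> n \<in> borel_measurable P" by (rule measurable_deviation)
  show ?thesis unfolding bad_def by (intro sets.Un short_horizon_sets) measurable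
qed

lemma bad_prob: "(\<lambda>n. measure P (bad n)) \<in> o(\<lambda>n. real n powr (- q))"
proof -
  let ?A = "\<lambda>n. {\<omega> \<in> space P. \<delta> n \<le> deviation \<epsilon> n \<omega>}"
  have A: "?A n \<in> sets P" for n
    using measurable_deviation[of \<epsilon> n] by measurable
  have "(\<lambda>n. measure P (short_horizon \<epsilon> n)) \<in> O(\<lambda>n. 2 * exp (- real n / 6))"
    using short_horizon_prob[OF \<epsilon>]
    by (intro bigoI[where c = 1] eventually_mono[OF eventually_ge_at_top[of l0]]) simp
  also have "(\<lambda>n. 2 * exp (- real n / 6)) \<in> o(\<lambda>n. real n powr (- q))"
    using q by real_asymp
  finally have "(\<lambda>n. measure P (?A n) + measure P (short_horizon \<epsilon> n)) \<in> o(\<lambda>n. real n powr (- q))"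
    by (rule sum_in_smallo(1)[OF dev])
  moreover have "(\<lambda>n. measure P (bad n)) \<in> O(\<lambda>n. measure P (?A n) + measure P (short_horizon \<epsilon> n))"
  proof (intro bigoI[where c = 1] always_eventually allI)
    fix n
    have "measure P (bad n) \<le> measure P (?A n) + measure P (short_horizon \<epsilon> n)"
      unfolding bad_def by (intro measure_Un_le A short_horizon_sets)
    then show "norm (measure P (bad n)) \<le> 1 * norm (measure P (?A n) + measure P (short_horizon \<epsilon> n))"
      by simp
  qed
  ultimately show ?thesis
    by (rule landau_o.big_small_trans[rotated])
qed

text \<open>The choice \<open>c k = k\<close> makes about \<open>n\<^sup>\<epsilon> / 2\<close> terms of the series vanish, so that the rest is
  exponentially small in \<open>n\<^sup>\<epsilon>\<close> and only the deviation of the arrival times matters. The outer measure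
  is bounded through the measurable event \<open>bad n\<close> and a null set.\<close>

lemma dJ1_outer_measure:
  assumes small: "\<forall>\<^sub>F n in sequentially. (1/2) ^ nat \<lfloor>real n powr \<epsilon> / 2\<rfloor> < \<eta> n"
    and le: "\<forall>\<^sub>F n in sequentially. \<delta> n \<le> \<eta> n"
  shows "(\<lambda>n. enn2real (outer_measure_of P {\<omega> \<in> space P. ennreal (\<eta> n) \<le> dJ1 real (Jn n \<omega>) (J \<omega>)}))
           \<in> o(\<lambda>n. real n powr (- q))"
proof (rule landau_o.big_small_trans[OF _ bad_prob])
  let ?D = "\<lambda>n. {\<omega> \<in> space P. ennreal (\<eta> n) \<le> dJ1 real (Jn n \<omega>) (J \<omega>)}"
  obtain Z where Z: "Z \<in> null_sets P" "{\<omega> \<in> space P. \<not> regular \<omega>} \<subseteq> Z"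
    using AE_regular by (auto elim!: AE_E simp: null_sets_def)
  have "\<forall>\<^sub>F n in sequentially. enn2real (outer_measure_of P (?D n)) \<le> measure P (bad n)"
    using small le eventually_ge_at_top[of l0]
  proof eventually_elim
    case (elim n)
    have "?D n \<subseteq> bad n \<union> Z"
    proof
      fix \<omega> assume \<omega>: "\<omega> \<in> ?D n"
      show "\<omega> \<in> bad n \<union> Z"
      proof (rule ccontr)
        assume "\<omega> \<notin> bad n \<union> Z"
        then have good: "regular \<omega>" "\<omega> \<notin> short_horizon \<epsilon> n" "deviation \<epsilon> n \<omega> < \<delta> n"
          using \<omega> Z(2) by (auto simp: bad_def)
        have "dJ1 real (Jn n \<omega>) (J \<omega>)
            \<le> ennreal (max ((1/2) ^ nat \<lfloor>real n powr \<epsilon> / 2\<rfloor>) (deviation \<epsilon> n \<omega>))"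
          by (rule dJ1_resampled_le[OF good(1) elim(3) \<epsilon> good(2)]) (auto simp: le_nat_iff le_floor_iff)
        also have "\<dots> < ennreal (\<eta> n)"
          using elim good(3) by (intro ennreal_lessI) (auto intro: less_trans[rotated])
        finally show False using \<omega> leD by blast
      qed
    qed
    then have "outer_measure_of P (?D n) \<le> outer_measure_of P (bad n \<union> Z)"
      by (rule outer_measure_of_mono)
    also have "\<dots> = emeasure P (bad n)"
      using Z(1) bad_sets[of n] by (subst outer_measure_of_eq) (auto simp: emeasure_Un_null_set)
    finally show ?case
      by (simp add: nn.emeasure_eq_measure enn2real_leI)
  qed
  then show "(\<lambda>n. enn2real (outer_measure_of P (?D n))) \<in> O(\<lambda>n. measure P (bad n))"
    by (intro bigoI[where c = 1]) (auto elim: eventually_mono)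
qed

text \<open>By the Borel-Cantelli lemma only finitely many of the events \<open>bad n\<close> occur. For arbitrary \<open>c\<close> any
  fixed number of terms of the series vanishes eventually, since \<open>n\<^sup>\<epsilon> / 2\<close> exceeds each \<open>c k\<close>.\<close>

lemma AE_J1_limit:
  assumes q1: "1 < q" and lim: "\<delta> \<longlonglongrightarrow> 0" and c: "filterlim c at_top sequentially"
  shows "AE \<omega> in P. limitin (J1_topology c S) (\<lambda>n. Jn n \<omega>) (J \<omega>) sequentially"
proof -
  have "summable (\<lambda>n. measure P (bad n))"
  proof (rule summable_comparison_test_bigo)
    show "summable (\<lambda>n. norm (real n powr (- q)))"
      using q1 by (simp add: summable_real_powr_iff)
    show "(\<lambda>n. measure P (bad n)) \<in> O(\<lambda>n. real n powr (- q))"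
      by (intro landau_o.small_imp_big bad_prob)
  qed
  then have "AE \<omega> in P. \<forall>\<^sub>F n in sequentially. \<omega> \<in> space P - bad n"
    by (intro borel_cantelli_AE1 bad_sets) (auto simp: nn.emeasure_eq_measure)
  then show ?thesis
    using AE_regular
  proof eventually_elim
    case (elim \<omega>)
    have to_0: "\<forall>\<^sub>F n in sequentially. dJ1 c (Jn n \<omega>) (J \<omega>) < r" if r: "0 < r" for r :: ennreal
    proof -
      obtain e' where e': "0 < e'" "e' < r"
        using dense[OF r] by blast
      then obtain e where e: "0 < e" "ennreal e < r"
        by (cases e') auto
      obtain K where K: "(1/2 :: real) ^ K < e"
        using real_arch_pow_inv[OF e(1), of "1/2"] by auto
      have "\<forall>\<^sub>F n in sequentially. \<forall>k\<in>{1..K}. c k \<le> real n powr \<epsilon> / 2"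
      proof (intro eventually_ball_finite ballI)
        fix k
        have "filterlim (\<lambda>n. real n powr \<epsilon> / 2) at_top sequentially"
          using \<epsilon> by real_asymp
        then show "\<forall>\<^sub>F n in sequentially. c k \<le> real n powr \<epsilon> / 2"
          by (simp add: filterlim_at_top)
      qed simp
      moreover have "\<forall>\<^sub>F n in sequentially. \<delta> n < e"
        using lim e(1) by (rule order_tendstoD)
      ultimately show ?thesis
        using elim(1) eventually_ge_at_top[of l0]
      proof eventually_elim
        case (elim n)
        have "dJ1 c (Jn n \<omega>) (J \<omega>) \<le> ennreal (max ((1/2) ^ K) (deviation \<epsilon> n \<omega>))"
          using elim \<open>regular \<omega>\<close> by (intro dJ1_resampled_le \<epsilon>) (auto simp: bad_def)
        also have "\<dots> \<le> ennreal e"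
          using elim K by (intro ennreal_leI) (auto simp: bad_def)
        finally show ?case using e(2) by simp
      qed
    qed
    show ?case
      unfolding limitin_def topspace_J1_topology openin_J1_topology
    proof (intro conjI allI impI J_cadlag[OF elim(2)])
      fix G assume G: "J1_open c S G \<and> J \<omega> \<in> G"
      then obtain r where r: "0 < r" "{y \<in> cadlag_paths S. dJ1 c y (J \<omega>) < r} \<subseteq> G"
        unfolding J1_open_def by blast
      show "\<forall>\<^sub>F n in sequentially. Jn n \<omega> \<in> G"
        using to_0[OF r(1)] eventually_ge_at_top[of l0]
        by eventually_elim (use r(2) Jn_cadlag[OF elim(2)] in blast)
    qed
  qed
qed

end

end


section \<open>The jump process with a given intensity matrix function\<close>

text \<open>For nonnegative weights the cells are disjoint. Without that the definite description in
  \<^const>\<open>select_state\<close> could denote a number outside \<open>{1..p}\<close>.\<close>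

lemma select_state_in_states:
  assumes w: "\<And>j. j \<in> {1..p} \<Longrightarrow> 0 \<le> w j"
  shows "select_state p w u \<in> states p"
proof (cases "\<exists>k\<in>{1..p}. in_cell w u k")
  case True
  have disjoint: False
    if k: "k \<in> {1..p}" "k' \<in> {1..p}" "k < k'" and cells: "in_cell w u k" "in_cell w u k'" for k k'
  proof -
    have "(\<Sum>j=1..k. w j) \<le> (\<Sum>j=1..<k'. w j)"
      using k w by (intro sum_mono2) auto
    then show False using cells by (simp add: in_cell_def)
  qed
  then have "\<exists>!k. k \<in> {1..p} \<and> in_cell w u k"
    using True by (metis linorder_neqE_nat)
  then have "(THE k. k \<in> {1..p} \<and> in_cell w u k) \<in> {1..p}"
    by (rule theI'[THEN conjunct1])
  then show ?thesis
    using True by (simp add: select_state_def states_def)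
qed (simp add: select_state_def states_def)

text \<open>This is where the intensity \<open>lambda0\<close> has to dominate all exit rates.\<close>

lemma uniformized_weight_nonneg:
  assumes \<Lambda>: "intensity_matrix_function p \<Lambda>" and bdd: "bdd_above (exit_rates p \<Lambda>)"
    and l0: "0 < lambda0 p \<Lambda>" and ij: "i \<in> {1..p}" "j \<in> {1..p}" and t: "0 \<le> t"
  shows "0 \<le> \<Lambda> i j t / real (lambda0 p \<Lambda>) + (if i = j then 1 else 0)"
proof (cases "i = j")
  case True
  have "\<bar>\<Lambda> i i t\<bar> \<le> Sup (exit_rates p \<Lambda>)"
    using ij t by (intro cSup_upper bdd) (auto simp: exit_rates_def)
  also have "\<dots> \<le> real (lambda0 p \<Lambda>)"
    unfolding lambda0_def by linarith
  finally have "- real (lambda0 p \<Lambda>) \<le> \<Lambda> i i t" by simp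
  then show ?thesis
    using True l0 by (simp add: field_simps)
next
  case False
  then show ?thesis
    using \<Lambda> ij t by (simp add: intensity_matrix_function_def)
qed

lemma embedded_chain_in_states:
  assumes \<Lambda>: "intensity_matrix_function p \<Lambda>" "bdd_above (exit_rates p \<Lambda>)" "0 < lambda0 p \<Lambda>"
    and \<alpha>: "probability_vector p \<alpha>" and T: "\<And>l. 0 \<le> T l"
  shows "embedded_chain p \<Lambda> \<alpha> (lambda0 p \<Lambda>) T u l \<in> states p"
proof (induction l)
  case 0
  show ?case
    using \<alpha> by (auto simp: probability_vector_def intro!: select_state_in_states)
next
  case (Suc l)
  show ?case
  proof (cases "embedded_chain p \<Lambda> \<alpha> (lambda0 p \<Lambda>) T u l")
    case None
    then show ?thesis by (simp add: states_def)
  next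
    case (Some i)
    then have "i \<in> {1..p}" using Suc by (auto simp: states_def)
    then show ?thesis
      using Some T by (simp only: embedded_chain.simps option.case)
        (intro select_state_in_states uniformized_weight_nonneg \<Lambda>; simp)
  qed
qed

theorem theorem3:
  fixes P :: "'w measure"
    and p l0 :: nat
    and \<Lambda> :: "nat \<Rightarrow> nat \<Rightarrow> real \<Rightarrow> real"
    and \<alpha> :: "nat \<Rightarrow> real"
    and N M :: "real \<Rightarrow> 'w \<Rightarrow> nat"
    and Nh Mh :: "nat \<Rightarrow> real \<Rightarrow> 'w \<Rightarrow> nat"
    and U :: "nat \<Rightarrow> 'w \<Rightarrow> real"
    and Nn Mn :: "nat \<Rightarrow> real \<Rightarrow> 'w \<Rightarrow> nat"
    and J :: "'w \<Rightarrow> real \<Rightarrow> nat option"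
    and Jn :: "nat \<Rightarrow> 'w \<Rightarrow> real \<Rightarrow> nat option"
    and \<kappa> :: "real \<Rightarrow> real \<Rightarrow> real"
  assumes "prob_space P"
    and "p \<ge> 1"
    and "intensity_matrix_function p \<Lambda>"
    and "bdd_above (exit_rates p \<Lambda>)"
    and "probability_vector p \<alpha>"
    and "l0 = lambda0 p \<Lambda>" and "l0 > 0"
    and "poisson_process P (real l0) N"
    and "poisson_process P (real l0) M"
    and "\<And>k. k \<ge> l0 + 1 \<Longrightarrow> poisson_process P 1 (Nh k)"
    and "\<And>k. k \<ge> l0 + 1 \<Longrightarrow> poisson_process P 1 (Mh k)"
    and "\<And>l. U l \<in> borel_measurable P"
    and "\<And>l. distr P borel (U l) = uniform_measure lborel {0<..<1}"
    and "independent_components P l0 N M Nh Mh U"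
    and "J = jump_process p \<Lambda> \<alpha> l0 N U"
    and "\<And>n. Nn n = superposition l0 N Nh n"
    and "\<And>n. Mn n = superposition l0 M Mh n"
    and "\<And>n. Jn n = approx_process J (Nn n) (Mn n)"
    and "\<And>q \<epsilon>. q > 0 \<Longrightarrow> 0 < \<epsilon> \<Longrightarrow> \<epsilon> < 1 \<Longrightarrow> \<kappa> q \<epsilon> > 0"
    and "\<And>q \<epsilon>. q > 0 \<Longrightarrow> 0 < \<epsilon> \<Longrightarrow> \<epsilon> < 1 \<Longrightarrow>
           (\<lambda>n. measure P {\<omega> \<in> space P.
              (MAX l\<in>{1..nat \<lfloor>real n powr (1 + \<epsilon>)\<rfloor>}. \<bar>arrival (Mn n) \<omega> l - arrival (Nn n) \<omega> l\<bar>)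
                \<ge> \<kappa> q \<epsilon> * ln (real n) * real n powr (-1/2 + \<epsilon>/2)})
           \<in> o(\<lambda>n. real n powr (-q))"
  shows "(\<forall>q \<epsilon>. q > 0 \<and> 0 < \<epsilon> \<and> \<epsilon> < 1 \<longrightarrow>
            (\<exists>c :: nat \<Rightarrow> real. (\<forall>k\<ge>1. c k \<ge> 0) \<and> filterlim c at_top sequentially \<and>
               (\<lambda>n. enn2real (outer_measure_of P {\<omega> \<in> space P.
                  dJ1 c (Jn n \<omega>) (J \<omega>)
                    \<ge> ennreal (3 * \<kappa> q \<epsilon> * ln (real n) * real n powr (-1/2 + \<epsilon>/2))}))
               \<in> o(\<lambda>n. real n powr (-q))))
       \<and> (\<forall>c :: nat \<Rightarrow> real. (\<forall>k\<ge>1. c k \<ge> 0) \<longrightarrow> filterlim c at_top sequentially \<longrightarrow>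
            (AE \<omega> in P. limitin (J1_topology c (states p)) (\<lambda>n. Jn n \<omega>) (J \<omega>) sequentially))"
proof -
  interpret prob_space P by (rule assms(1))
  define hN where "hN k = (if k = l0 then C_N else C_Nh k)" for k
  define hM where "hM k = (if k = l0 then C_M else C_Mh k)" for k
  define Y where "Y \<omega> = embedded_chain p \<Lambda> \<alpha> l0 (arrival N \<omega>) (\<lambda>l. U l \<omega>)" for \<omega>
  let ?E = "component_events P N M Nh Mh U"
  have ind: "indep_sets ?E
      ({C_N, C_M} \<union> C_Nh ` {l0 + 1..} \<union> C_Mh ` {l0 + 1..} \<union> range C_U)"
    using assms(14) by (simp add: independent_components_def)
  have indN: "indep_sets ?E (hN ` {l0..})" and indM: "indep_sets ?E (hM ` {l0..})"
    by (rule indep_sets_mono_index[OF _ ind]; auto simp: hN_def hM_def)+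
  interpret R: resampled_step_process P l0 N M Nh Mh ?E hN hM Y "states p"
  proof (intro resampled_step_process.intro independent_superposition.intro
      independent_superposition_axioms.intro resampled_step_process_axioms.intro)
    show "inj_on hN {l0..}" "inj_on hM {l0..}"
      by (auto simp: inj_on_def hN_def hM_def split: if_splits)
    show "Y \<omega> l \<in> states p" if "onto_counting_path (\<lambda>t. N t \<omega>)" for \<omega> l
      using embedded_chain_in_states[OF assms(3,4) _ assms(5) onto_arrival_nonneg[of N, OF that]] assms(6,7)
      by (simp add: Y_def)
  qed (use assms(1,7-11) indN indM in \<open>auto simp: hN_def hM_def\<close>)
  have RJ: "R.J = J"
    unfolding assms(15) by (intro ext) (simp add: R.J_def jump_process_def Y_def)
  have RJn: "R.Jn = Jn"
    by (intro ext) (simp add: R.Jn_def RJ assms(16-18))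
  define \<delta> where "\<delta> q \<epsilon> n = \<kappa> q \<epsilon> * ln (real n) * real n powr (-1/2 + \<epsilon>/2)" for q \<epsilon> n
  have dev: "(\<lambda>n. measure P {\<omega> \<in> space P. \<delta> q \<epsilon> n \<le> R.deviation \<epsilon> n \<omega>}) \<in> o(\<lambda>n. real n powr (- q))"
    if "q > 0" "0 < \<epsilon>" "\<epsilon> < 1" for q \<epsilon>
    using assms(20)[OF that] by (simp add: R.deviation_def R.sample_size_def \<delta>_def assms(16,17))
  have rate: "(\<lambda>n. enn2real (outer_measure_of P {\<omega> \<in> space P.
        dJ1 real (Jn n \<omega>) (J \<omega>) \<ge> ennreal (3 * \<kappa> q \<epsilon> * ln (real n) * real n powr (-1/2 + \<epsilon>/2))}))
      \<in> o(\<lambda>n. real n powr (-q))" if q: "q > 0" and \<epsilon>: "0 < \<epsilon>" "\<epsilon> < 1" for q \<epsilon>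
  proof -
    have \<kappa>: "0 < \<kappa> q \<epsilon>" by (rule assms(19)[OF q \<epsilon>])
    have "\<forall>\<^sub>F n in sequentially. (1/2) ^ nat \<lfloor>real n powr \<epsilon> / 2\<rfloor> < 3 * \<delta> q \<epsilon> n"
    proof -
      have "\<forall>\<^sub>F n in sequentially. 2 * exp (- (ln 2 / 2) * real n powr \<epsilon>) < 3 * \<delta> q \<epsilon> n"
        unfolding \<delta>_def using \<epsilon> \<kappa> by real_asymp
      then show ?thesis
      proof eventually_elim
        case (elim n)
        let ?x = "real n powr \<epsilon> / 2"
        have "(1/2 :: real) ^ nat \<lfloor>?x\<rfloor> = (1/2) powr real (nat \<lfloor>?x\<rfloor>)"
          by (rule powr_realpow[symmetric]) simp
        also have "\<dots> \<le> (1/2) powr (?x - 1)"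
          by (intro powr_mono') linarith+
        also have "\<dots> = exp (ln 2 + - (ln 2 / 2) * real n powr \<epsilon>)"
          by (simp add: powr_def[of "1/2"] ln_div algebra_simps)
        also have "\<dots> = 2 * exp (- (ln 2 / 2) * real n powr \<epsilon>)"
          by (simp only: exp_add) simp
        finally show ?case using elim by simp
      qed
    qed
    moreover have "\<forall>\<^sub>F n in sequentially. \<delta> q \<epsilon> n \<le> 3 * \<delta> q \<epsilon> n"
      unfolding \<delta>_def using eventually_ge_at_top[of 1] by eventually_elim (use \<kappa> in simp)
    ultimately have "(\<lambda>n. enn2real (outer_measure_of P {\<omega> \<in> space P.
        ennreal (3 * \<delta> q \<epsilon> n) \<le> dJ1 real (R.Jn n \<omega>) (R.J \<omega>)})) \<in> o(\<lambda>n. real n powr (-q))"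
      by (rule R.dJ1_outer_measure[OF \<epsilon>(1) q dev[OF q \<epsilon>]])
    moreover have "3 * \<kappa> q \<epsilon> * ln (real n) * real n powr (-1/2 + \<epsilon>/2) = 3 * \<delta> q \<epsilon> n" for n
      by (simp add: \<delta>_def)
    ultimately show ?thesis
      by (simp only: RJ RJn)
  qed
  have limit: "AE \<omega> in P. limitin (J1_topology c (states p)) (\<lambda>n. Jn n \<omega>) (J \<omega>) sequentially"
    if c: "filterlim c at_top sequentially" for c :: "nat \<Rightarrow> real"
  proof -
    \<comment> \<open>Any \<open>q > 1\<close> gives summable probabilities, and any \<open>\<epsilon> < 1\<close> gives a null sequence of bounds.\<close>
    have "\<delta> 2 (1/2) \<longlonglongrightarrow> 0"
      unfolding \<delta>_def[abs_def] by real_asymp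
    then show ?thesis
      using R.AE_J1_limit[of "1/2" 2 "\<delta> 2 (1/2)" c] dev[of 2 "1/2"] c by (simp add: RJ RJn)
  qed
  show ?thesis
    by (intro conjI allI impI exI[of _ real] of_nat_0_le_iff filterlim_real_sequentially rate limit; simp)
qed

end
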